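(* Fix integers $k_1,k_2\ge0$ with $k=k_1+k_2\ge1$. Let $\mathcal{B}_{k_1,k_2}(X)$ be the number of pure quartic fields $K=\mathbb{Q}(\sqrt[4]{a})$, where $a\ne\pm1$ is an integer such that every prime $p$ with $p^\nu\parallel a$ has $\gcd(\nu,4)=1$, with $\omega_1(a)=k_1$, $\omega_3(a)=k_2$ and $|\mathcal{D}_K|\le X$. Then, as $X\to\infty$, $$\mathcal{B}_{k_1,k_2}(X)=O\!\left(\frac{X}{(k-1)!\,\log X}(\log\log X)^{k-1}\right).$$
   Context: $\mathcal{D}_K$ is the discriminant of $K$. For an integer $a$, $\omega_1(a)$ (resp. $\omega_3(a)$) is the number of distinct primes $p\mid a$ with $p\equiv1\pmod4$ (resp. $p\equiv3\pmod4$). *)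

theory Defs
  imports
    "HOL-Computational_Algebra.Computational_Algebra"
    "HOL-Library.FuncSet"
    "HOL-Number_Theory.Cong"
    "HOL-Library.Landau_Symbols"
    "Jordan_Normal_Form.Determinant"
begin

text \<open>Number fields are represented as subfields of the complex numbers.\<close>

definition complex_subfield :: "complex set \<Rightarrow> bool" where
  "complex_subfield F \<longleftrightarrow>
     0 \<in> F \<and> 1 \<in> F \<and>
     (\<forall>x\<in>F. \<forall>y\<in>F. x + y \<in> F \<and> x * y \<in> F) \<and>
     (\<forall>x\<in>F. - x \<in> F \<and> inverse x \<in> F)"

text \<open>The field generated by \<open>\<alpha>\<close> over the rationals; every subfield of the complex numbers
  contains the rationals.\<close>

definition rat_adjoin :: "complex \<Rightarrow> complex set" where
  "rat_adjoin \<alpha> = complex_subfield hull {\<alpha>}"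

definition field_degree :: "complex set \<Rightarrow> nat" where
  "field_degree K = vector_space.dim (\<lambda>(q::rat) (x::complex). of_rat q * x) K"

text \<open>The embeddings are made extensional so that each embedding of \<open>K\<close> is a single HOL function;
  otherwise sums over embeddings would range over an infinite set.\<close>

definition field_embeddings :: "complex set \<Rightarrow> (complex \<Rightarrow> complex) set" where
  "field_embeddings K =
     {\<sigma> \<in> extensional K. \<sigma> 1 = 1 \<and>
        (\<forall>x\<in>K. \<forall>y\<in>K. \<sigma> (x + y) = \<sigma> x + \<sigma> y \<and> \<sigma> (x * y) = \<sigma> x * \<sigma> y)}"

definition field_trace :: "complex set \<Rightarrow> complex \<Rightarrow> complex" where
  "field_trace K x = (\<Sum>\<sigma>\<in>field_embeddings K. \<sigma> x)"

definition ring_of_integers :: "complex set \<Rightarrow> complex set" where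
  "ring_of_integers K = {x \<in> K. algebraic_int x}"

definition integral_basis :: "complex set \<Rightarrow> complex list \<Rightarrow> bool" where
  "integral_basis K \<omega> \<longleftrightarrow>
     set \<omega> \<subseteq> ring_of_integers K \<and>
     (\<forall>x\<in>ring_of_integers K.
        \<exists>!c :: int list. length c = length \<omega> \<and> x = (\<Sum>i<length \<omega>. of_int (c ! i) * \<omega> ! i))"

text \<open>The determinant of the trace form on an integral basis. For a number field this is a rational
  integer independent of the basis; it is kept as a complex number here.\<close>

definition field_discriminant :: "complex set \<Rightarrow> complex" where
  "field_discriminant K =
     (let \<omega> = (SOME \<omega>. integral_basis K \<omega>); n = length \<omega>
      in det (mat n n (\<lambda>(i, j). field_trace K (\<omega> ! i * \<omega> ! j))))"

definition field_iso :: "complex set \<Rightarrow> complex set \<Rightarrow> bool" where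
  "field_iso K L \<longleftrightarrow> (\<exists>\<sigma>\<in>field_embeddings K. \<sigma> ` K = L)"

definition omega1 :: "int \<Rightarrow> nat" where
  "omega1 a = card {p \<in> prime_factors a. [p = 1] (mod 4)}"

definition omega3 :: "int \<Rightarrow> nat" where
  "omega3 a = card {p \<in> prime_factors a. [p = 3] (mod 4)}"

text \<open>Any complex fourth root \<open>\<alpha>\<close> of \<open>a\<close> is admitted: the different choices generate
  isomorphic fields, and fields are counted up to isomorphism below.\<close>

definition pure_quartic_fields :: "nat \<Rightarrow> nat \<Rightarrow> real \<Rightarrow> complex set set" where
  "pure_quartic_fields k1 k2 X =
     {K. field_degree K = 4 \<and> cmod (field_discriminant K) \<le> X \<and>
         (\<exists>(a::int) \<alpha>. \<alpha> ^ 4 = of_int a \<and> K = rat_adjoin \<alpha> \<and>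
            a \<noteq> 0 \<and> a \<noteq> 1 \<and> a \<noteq> - 1 \<and>
            (\<forall>p\<in>prime_factors a. gcd (multiplicity p a) 4 = 1) \<and>
            omega1 a = k1 \<and> omega3 a = k2)}"

definition count_pure_quartic :: "nat \<Rightarrow> nat \<Rightarrow> real \<Rightarrow> nat" where
  "count_pure_quartic k1 k2 X =
     card (pure_quartic_fields k1 k2 X // {(K, L). field_iso K L})"

end

theory Submission
  imports
    Defs
    "HOL-Computational_Algebra.Field_as_Ring"
    "HOL-Real_Asymp.Real_Asymp"
    "Jordan_Normal_Form.Char_Poly"
begin

text \<open>
  Write \<open>a = d\<^sup>4 b c\<^sup>3\<close> with \<open>b c\<close> squarefree; \<open>K\<close> is generated by \<open>\<alpha>\<close> with \<open>\<alpha>\<^sup>4 = b c\<^sup>3\<close>. Summing the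
  conjugates of an integer \<open>\<Sum> q\<^sub>k \<alpha>\<^sup>k\<close> of \<open>K\<close> against powers of \<open>\<i>\<close> shows that each \<open>4 q\<^sub>k \<alpha>\<^sup>k\<close> is
  integral, so that the ring of integers lies in the lattice spanned by
  \<open>1/4\<close>, \<open>\<alpha>/4\<close>, \<open>\<alpha>\<^sup>2/(4c)\<close>, \<open>\<alpha>\<^sup>3/(4c\<^sup>2)\<close>, whose discriminant has absolute value \<open>\<bar>b c\<bar>\<^sup>3/256\<close>. Hence
  \<open>\<bar>\<D>\<^sub>K\<bar> \<ge> \<bar>b c\<bar>\<^sup>3/256\<close>, and \<open>b\<close>, \<open>c\<close> are \<open>O(X\<^bsup>1/3\<^esup>)\<close>. Each pair \<open>(b, c)\<close> accounts for at most four
  subfields of the complex numbers, so there are only \<open>O(X\<^bsup>2/3\<^esup>)\<close> fields in total.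
\<close>

section \<open>Algebraic integers\<close>

interpretation zmod: Modules.module "\<lambda>(k::int) (x::complex). of_int k * x"
  by unfold_locales (simp_all add: algebra_simps)

interpretation qvs: Vector_Spaces.vector_space "\<lambda>(q::rat) (x::complex). of_rat q * x"
  by unfold_locales (simp_all add: algebra_simps of_rat_add of_rat_mult)

text \<open>The determinant trick: \<open>z\<close> is an eigenvalue of the integer matrix describing
  multiplication by \<open>z\<close> on the generators.\<close>

lemma algebraic_int_if_finite_module:
  fixes z :: complex
  assumes fin: "finite G" and g0: "g0 \<in> G" "g0 \<noteq> 0"
    and closed: "\<And>g. g \<in> G \<Longrightarrow> z * g \<in> zmod.span G"
  shows "algebraic_int z"
proof -
  define n where "n = card G"
  obtain h where h: "bij_betw h {0..<n} G"
    unfolding n_def using ex_bij_betw_nat_finite[OF fin] by blast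
  have "\<forall>g\<in>G. \<exists>c. z * g = (\<Sum>y\<in>G. of_int (c y) * y)"
    using closed by (simp add: zmod.span_finite[OF fin] image_iff)
  from bchoice[OF this]
  obtain c where c: "\<And>g. g \<in> G \<Longrightarrow> z * g = (\<Sum>y\<in>G. of_int (c g y) * y)"
    by blast
  define M :: "int mat" where "M = mat n n (\<lambda>(i,j). c (h i) (h j))"
  define v where "v = vec n h"
  have M: "M \<in> carrier_mat n n" by (simp add: M_def)
  have "map_mat of_int M *\<^sub>v v = z \<cdot>\<^sub>v v"
  proof
    fix i assume "i < dim_vec (z \<cdot>\<^sub>v v)"
    then have i: "i < n" by (simp add: v_def)
    then have "h i \<in> G" using h by (auto simp: bij_betw_def)
    from c[OF this] have "z * h i = (\<Sum>j\<in>{0..<n}. of_int (c (h i) (h j)) * h j)"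
      using sum.reindex_bij_betw[OF h, of "\<lambda>y. of_int (c (h i) y) * y"] by simp
    then show "(map_mat of_int M *\<^sub>v v) $ i = (z \<cdot>\<^sub>v v) $ i"
      using i by (simp add: M_def v_def scalar_prod_def)
  qed (simp add: M_def v_def)
  moreover obtain i where "i < n" "h i = g0"
    using h g0 by (auto simp: bij_betw_def)
  then have "v \<noteq> 0\<^sub>v n"
    using g0 by (metis index_vec index_zero_vec(1) v_def)
  ultimately have "eigenvalue (map_mat of_int M) z"
    unfolding eigenvalue_def eigenvector_def using M
    by (intro exI[of _ v] conjI) (simp_all add: v_def)
  then have "poly (char_poly (map_mat of_int M)) z = 0"
    by (subst (asm) eigenvalue_root_char_poly[of _ n]) (use M in simp_all)
  then have "poly (map_poly of_int (char_poly M)) z = 0"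
    by (simp add: of_int_hom.char_poly_hom[OF M])
  then show ?thesis
    unfolding algebraic_int_altdef_ipoly using degree_monic_char_poly[OF M] by auto
qed

text \<open>Solving a monic integer relation for its leading power gives a rule that lowers
  exponents; \<open>m = 0\<close> would make it read 1 = 0.\<close>

lemma algebraic_int_power_reduction:
  fixes x :: complex
  assumes "algebraic_int x"
  obtains m c where "m > 0" "x ^ m = (\<Sum>i<m. of_int (c i) * x ^ i)"
proof -
  obtain p where p: "poly (map_poly of_int p) x = 0" "lead_coeff p = 1"
    using assms unfolding algebraic_int_altdef_ipoly by blast
  define m where "m = degree p"
  have "poly (map_poly of_int p) x = (\<Sum>i\<le>m. of_int (coeff p i) * x ^ i)"
    by (simp add: poly_altdef m_def)
  also have "\<dots> = (\<Sum>i<m. of_int (coeff p i) * x ^ i) + x ^ m"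
    using p(2) by (simp add: m_def lessThan_Suc_atMost[symmetric] del: lessThan_Suc_atMost)
  finally have "x ^ m = - (\<Sum>i<m. of_int (coeff p i) * x ^ i)"
    unfolding p(1) by (metis add.inverse_unique add.inverse_inverse)
  also have "\<dots> = (\<Sum>i<m. of_int (- coeff p i) * x ^ i)"
    by (simp add: sum_negf)
  finally have eq: "x ^ m = (\<Sum>i<m. of_int (- coeff p i) * x ^ i)" .
  have "m > 0"
  proof (rule ccontr)
    assume "\<not> m > 0"
    with eq show False by simp
  qed
  with eq show thesis by (intro that)
qed

text \<open>The monomials \<open>x ^ i * y ^ j\<close> below the two reduction degrees generate a
  module stable under multiplication by \<open>x\<close> and by \<open>y\<close>, hence by their sum
  and product. The determinant trick then applies to \<open>G\<close>, with 1 as nonzero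
  generator.\<close>

lemma algebraic_int_add_mult:
  fixes x y :: complex
  assumes "algebraic_int x" "algebraic_int y"
  shows "algebraic_int (x + y)" "algebraic_int (x * y)"
proof -
  obtain m c where m: "m > 0" "x ^ m = (\<Sum>i<m. of_int (c i) * x ^ i)"
    using algebraic_int_power_reduction[OF assms(1)] by metis
  obtain n d where n: "n > 0" "y ^ n = (\<Sum>i<n. of_int (d i) * y ^ i)"
    using algebraic_int_power_reduction[OF assms(2)] by metis
  define G where "G = (\<lambda>(i,j). x ^ i * y ^ j) ` ({..<m} \<times> {..<n})"
  have fin: "finite G" by (simp add: G_def)
  have gen: "x ^ i * y ^ j \<in> G" if "i < m" "j < n" for i j
    using that by (auto simp: G_def)
  have one: "1 \<in> G" using gen[of 0 0] m n by simp
  have x_gen: "x * g \<in> zmod.span G" if "g \<in> G" for g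
  proof -
    from that obtain i j where ij: "i < m" "j < n" "g = x ^ i * y ^ j" by (auto simp: G_def)
    show ?thesis
    proof (cases "Suc i = m")
      case False
      then have "x ^ Suc i * y ^ j \<in> G" using ij by (intro gen) auto
      then show ?thesis using ij by (intro zmod.span_base) (simp add: mult.assoc)
    next
      case True
      have "x * g = x ^ m * y ^ j" using ij True[symmetric] by (simp add: mult.assoc)
      also have "\<dots> = (\<Sum>l<m. of_int (c l) * (x ^ l * y ^ j))"
        by (simp add: m sum_distrib_right mult.assoc)
      also have "\<dots> \<in> zmod.span G"
        using ij by (intro zmod.span_sum zmod.span_scale zmod.span_base gen) auto
      finally show ?thesis .
    qed
  qed
  have y_gen: "y * g \<in> zmod.span G" if "g \<in> G" for g
  proof -
    from that obtain i j where ij: "i < m" "j < n" "g = x ^ i * y ^ j" by (auto simp: G_def)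
    show ?thesis
    proof (cases "Suc j = n")
      case False
      then have "x ^ i * y ^ Suc j \<in> G" using ij by (intro gen) auto
      then show ?thesis using ij by (intro zmod.span_base) (simp add: mult_ac)
    next
      case True
      have "y * g = y ^ n * x ^ i" using ij True[symmetric] by (simp add: mult_ac)
      also have "\<dots> = (\<Sum>l<n. of_int (d l) * (x ^ i * y ^ l))"
        by (simp add: n sum_distrib_right sum_distrib_left mult_ac)
      also have "\<dots> \<in> zmod.span G"
        using ij by (intro zmod.span_sum zmod.span_scale zmod.span_base gen) auto
      finally show ?thesis .
    qed
  qed
  \<comment> \<open>In the product, \<open>x\<close> acts on \<open>y * g\<close>, which is known
    only to lie in the span, so stability has to pass from the generators to the whole
    module.\<close>
  have x_span: "x * w \<in> zmod.span G" if "w \<in> zmod.span G" for w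
  proof -
    from that obtain u where "w = (\<Sum>g\<in>G. of_int (u g) * g)"
      by (auto simp: zmod.span_finite[OF fin])
    then have "x * w = (\<Sum>g\<in>G. of_int (u g) * (x * g))"
      by (simp add: sum_distrib_left mult_ac)
    then show ?thesis by (simp add: zmod.span_sum zmod.span_scale x_gen)
  qed
  show "algebraic_int (x + y)"
    by (rule algebraic_int_if_finite_module[OF fin one])
       (auto simp: distrib_right intro: zmod.span_add x_gen y_gen)
  show "algebraic_int (x * y)"
    by (rule algebraic_int_if_finite_module[OF fin one])
       (auto simp: mult.assoc intro: x_span y_gen)
qed

lemma algebraic_int_power:
  fixes x :: complex
  shows "algebraic_int x \<Longrightarrow> algebraic_int (x ^ n)"
  by (induction n) (auto intro: algebraic_int_add_mult)

lemma algebraic_int_sum: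
  fixes f :: "'a \<Rightarrow> complex"
  shows "(\<And>i. i \<in> I \<Longrightarrow> algebraic_int (f i)) \<Longrightarrow> algebraic_int (sum f I)"
  by (induction I rule: infinite_finite_induct) (auto intro: algebraic_int_add_mult)

section \<open>Simple extensions of the rationals\<close>

definition rp :: "rat poly \<Rightarrow> complex \<Rightarrow> complex" where
  "rp f x = poly (map_poly of_rat f) x"

lemma rp_0 [simp]: "rp 0 x = 0"
  by (simp add: rp_def)

lemma rp_pCons [simp]: "rp (pCons c f) x = of_rat c + x * rp f x"
  by (simp add: rp_def Polynomial.map_poly_pCons)

lemma rp_1 [simp]: "rp 1 x = 1"
  by (simp add: one_pCons)

lemma rp_add [simp]: "rp (f + g) x = rp f x + rp g x"
  by (induction f g rule: poly_induct2) (simp_all add: of_rat_add algebra_simps)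

lemma rp_smult [simp]: "rp (Polynomial.smult c f) x = of_rat c * rp f x"
  by (induction f) (simp_all add: of_rat_mult algebra_simps)

lemma rp_minus [simp]: "rp (- f) x = - rp f x"
  using rp_smult[of "-1" f x] by simp

lemma rp_diff [simp]: "rp (f - g) x = rp f x - rp g x"
  using rp_add[of f "- g" x] by simp

lemma rp_mult [simp]: "rp (f * g) x = rp f x * rp g x"
  by (induction f) (simp_all add: algebra_simps)

lemma rp_sum: "rp (sum f A) x = (\<Sum>i\<in>A. rp (f i) x)"
  by (induction A rule: infinite_finite_induct) simp_all

lemma rp_pcompose: "rp (pcompose f g) x = rp f (rp g x)"
  by (induction f) (simp_all add: pcompose_pCons)

lemma rp_monom [simp]: "rp (monom c n) x = of_rat c * x ^ n"
  by (simp add: rp_def map_poly_monom poly_monom)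

lemma rp_of_int_poly: "rp (map_poly of_int p) x = poly (map_poly of_int p) x"
  by (induction p) (simp_all add: Polynomial.map_poly_pCons)

lemma rp_eq_sum:
  assumes "degree f < n"
  shows "rp f x = (\<Sum>i<n. of_rat (coeff f i) * x ^ i)"
proof -
  have "rp f x = (\<Sum>i\<le>degree f. of_rat (coeff f i) * x ^ i)"
    by (simp add: rp_def poly_altdef degree_map_poly coeff_map_poly)
  also have "\<dots> = (\<Sum>i<n. of_rat (coeff f i) * x ^ i)"
    using assms by (intro sum.mono_neutral_left) (auto simp: not_le coeff_eq_0)
  finally show ?thesis .
qed

lemma rp_mod: "rp g x = 0 \<Longrightarrow> rp (f mod g) x = rp f x"
  using rp_add[of "f div g * g" "f mod g" x] by simp

text \<open>A vanishing remainder has degree 0, so the bound could fail only for constant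
  \<open>g\<close>, and a nonzero constant has no root.\<close>

lemma degree_mod_annihilator:
  assumes "g \<noteq> 0" "rp g x = 0"
  shows "degree (f mod g) < degree g"
proof (rule ccontr)
  assume not: "\<not> ?thesis"
  then have "degree g = 0"
    using degree_mod_less[OF assms(1), of f] by auto
  then obtain c where "g = [:c:]" by (rule degree_eq_zeroE)
  with assms show False by simp
qed

section \<open>Subfields of the complex numbers generated by one algebraic number\<close>

lemma complex_subfieldD:
  assumes "complex_subfield F"
  shows "0 \<in> F" "1 \<in> F" "x \<in> F \<Longrightarrow> y \<in> F \<Longrightarrow> x + y \<in> F"
    "x \<in> F \<Longrightarrow> y \<in> F \<Longrightarrow> x * y \<in> F" "x \<in> F \<Longrightarrow> - x \<in> F" "x \<in> F \<Longrightarrow> inverse x \<in> F"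
  using assms unfolding complex_subfield_def by blast+

lemma complex_subfield_of_rat:
  assumes F: "complex_subfield F"
  shows "of_rat q \<in> F"
proof -
  have nat: "of_nat n \<in> F" for n
    by (induction n) (simp_all add: complex_subfieldD[OF F])
  have int: "of_int k \<in> F" for k
    by (cases k rule: int_cases2) (simp_all add: nat complex_subfieldD[OF F])
  obtain m n where mn: "quotient_of q = (m, n)" by (cases "quotient_of q")
  have "of_rat q = (of_int m / of_int n :: complex)"
    by (simp add: quotient_of_div[OF mn] of_rat_divide)
  then show ?thesis by (simp add: divide_inverse int complex_subfieldD[OF F])
qed

lemma mem_rat_adjoin_iff:
  "x \<in> rat_adjoin \<alpha> \<longleftrightarrow> (\<forall>F. complex_subfield F \<longrightarrow> \<alpha> \<in> F \<longrightarrow> x \<in> F)"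
  by (auto simp: rat_adjoin_def hull_def)

lemma rp_mem_subfield:
  assumes "complex_subfield F" "\<alpha> \<in> F"
  shows "rp f \<alpha> \<in> F"
  using assms(2)
  by (induction f) (simp_all add: complex_subfieldD[OF assms(1)] complex_subfield_of_rat[OF assms(1)])

text \<open>Take an annihilator \<open>m\<close> of least degree and \<open>h = gcd f m\<close>. As
  \<open>h\<close> divides \<open>f\<close>, it does not vanish at \<alpha>, so the cofactor of
  \<open>h\<close> in \<open>m\<close> annihilates \<alpha>. Minimality makes \<open>h\<close>
  constant, and Bezout yields the inverse.\<close>

lemma rp_inverse:
  assumes alg: "g \<noteq> 0" "rp g \<alpha> = 0" and nz: "rp f \<alpha> \<noteq> 0"
  obtains u where "rp u \<alpha> * rp f \<alpha> = 1"
proof -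
  define m where "m = arg_min degree (\<lambda>m. m \<noteq> 0 \<and> rp m \<alpha> = 0)"
  have m: "m \<noteq> 0" "rp m \<alpha> = 0"
    using arg_min_natI[of "\<lambda>m. m \<noteq> 0 \<and> rp m \<alpha> = 0" g degree] alg by (auto simp: m_def)
  have min: "degree m \<le> degree k" if "k \<noteq> 0" "rp k \<alpha> = 0" for k
    using arg_min_nat_le[of "\<lambda>m. m \<noteq> 0 \<and> rp m \<alpha> = 0" k degree] that by (auto simp: m_def)
  define h where "h = gcd f m"
  have h: "h dvd f" "h dvd m" by (simp_all add: h_def)
  from bezout_coefficients_fst_snd[of f m]
  obtain u v where uv: "u * f + v * m = h" unfolding h_def by blast
  have h_nz: "rp h \<alpha> \<noteq> 0"
  proof
    assume "rp h \<alpha> = 0"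
    moreover from h(1) obtain k where "f = h * k" by (rule dvdE)
    ultimately show False using nz by simp
  qed
  from h(2) obtain k where k: "m = h * k" by (rule dvdE)
  with m h_nz have "k \<noteq> 0" "rp k \<alpha> = 0" by auto
  from min[OF this] m k have "degree h = 0" by (auto simp: degree_mult_eq)
  then obtain c where "h = [:c:]" by (rule degree_eq_zeroE)
  with h_nz have c: "h = [:c:]" "c \<noteq> 0" by auto
  have "rp u \<alpha> * rp f \<alpha> = of_rat c"
    using arg_cong[OF uv, of "\<lambda>f. rp f \<alpha>"] m c by simp
  then have "rp (Polynomial.smult (inverse c) u) \<alpha> * rp f \<alpha> = 1"
    using c by (simp add: mult.assoc of_rat_mult[symmetric])
  then show thesis by (rule that)
qed

lemma rat_adjoin_eq_range:
  assumes alg: "g \<noteq> 0" "rp g \<alpha> = 0"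
  shows "rat_adjoin \<alpha> = range (\<lambda>f. rp f \<alpha>)"
proof
  let ?R = "range (\<lambda>f. rp f \<alpha>)"
  have "\<alpha> \<in> ?R" by (rule range_eqI[of _ _ "[:0, 1:]"]) simp
  moreover have "complex_subfield ?R"
    unfolding complex_subfield_def
  proof (intro conjI ballI)
    show "0 \<in> ?R" by (rule range_eqI[of _ _ 0]) simp
    show "1 \<in> ?R" by (rule range_eqI[of _ _ 1]) simp
  next
    fix x y assume "x \<in> ?R" "y \<in> ?R"
    then obtain f h where "x = rp f \<alpha>" "y = rp h \<alpha>" by blast
    then show "x + y \<in> ?R" "x * y \<in> ?R"
      by (auto intro: range_eqI[of _ _ "f + h"] range_eqI[of _ _ "f * h"])
  next
    fix x assume "x \<in> ?R"
    then obtain f where x: "x = rp f \<alpha>" by blast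
    then show "- x \<in> ?R" by (auto intro: range_eqI[of _ _ "- f"])
    show "inverse x \<in> ?R"
    proof (cases "x = 0")
      case True
      then show ?thesis by (intro range_eqI[of _ _ 0]) simp
    next
      case False
      with x obtain u where "rp u \<alpha> * x = 1" using rp_inverse[OF alg, of f] by blast
      then have "inverse x = rp u \<alpha>" using False by (simp add: field_simps)
      then show ?thesis by blast
    qed
  qed
  ultimately show "rat_adjoin \<alpha> \<subseteq> ?R" by (auto simp: mem_rat_adjoin_iff)
  show "?R \<subseteq> rat_adjoin \<alpha>" by (auto simp: mem_rat_adjoin_iff rp_mem_subfield)
qed

text \<open>Reduction modulo \<open>g\<close> shows that the powers of \<alpha> below
  \<open>degree g\<close> span. The bound serves in reverse: in degree 4, no nonzero polynomial of
  degree below 4 annihilates \<alpha>.\<close>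

lemma field_degree_le:
  assumes alg: "g \<noteq> 0" "rp g \<alpha> = 0"
  shows "field_degree (rat_adjoin \<alpha>) \<le> degree g"
proof -
  define B where "B = (\<lambda>i. \<alpha> ^ i) ` {..<degree g}"
  have "rat_adjoin \<alpha> \<subseteq> qvs.span B"
  proof
    fix x assume "x \<in> rat_adjoin \<alpha>"
    then obtain f where "x = rp (f mod g) \<alpha>"
      by (auto simp: rat_adjoin_eq_range[OF alg] rp_mod[OF alg(2)])
    also have "\<dots> = (\<Sum>i<degree g. of_rat (coeff (f mod g) i) * \<alpha> ^ i)"
      by (rule rp_eq_sum) (rule degree_mod_annihilator[OF alg])
    also have "\<dots> \<in> qvs.span B"
      by (intro qvs.span_sum qvs.span_scale qvs.span_base) (auto simp: B_def)
    finally show "x \<in> qvs.span B" .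
  qed
  then have "field_degree (rat_adjoin \<alpha>) \<le> card B"
    unfolding field_degree_def by (rule qvs.dim_le_card) (simp add: B_def)
  also have "\<dots> \<le> degree g"
    unfolding B_def using card_image_le[of "{..<degree g}"] by simp
  finally show ?thesis .
qed

text \<open>Orthogonality of the characters of Z/4: a geometric sum that depends only on
  \<open>n mod 4\<close>.\<close>

lemma sum_powers_ii: "(\<Sum>m<4. \<i> ^ (m * n)) = (if 4 dvd n then 4 else 0)"
proof -
  have "\<i> ^ n = \<i> ^ (4 * (n div 4) + n mod 4)" by simp
  also have "\<dots> = (\<i> ^ 4) ^ (n div 4) * \<i> ^ (n mod 4)"
    unfolding power_add power_mult ..
  also have "\<i> ^ 4 = 1" by (simp add: eval_nat_numeral)
  finally have w: "\<i> ^ n = \<i> ^ r" if "n mod 4 = r" for r using that by simp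
  have "(\<Sum>m<4. \<i> ^ (m * n)) = (\<Sum>m<4. (\<i> ^ n) ^ m)"
    by (simp only: power_mult[symmetric] mult.commute)
  also have "\<dots> = 1 + \<i> ^ n + (\<i> ^ n) ^ 2 + (\<i> ^ n) ^ 3"
    by (simp add: eval_nat_numeral)
  finally have sum: "(\<Sum>m<4. \<i> ^ (m * n)) = 1 + \<i> ^ n + (\<i> ^ n) ^ 2 + (\<i> ^ n) ^ 3" .
  consider "n mod 4 = 0" | "n mod 4 = 1" | "n mod 4 = 2" | "n mod 4 = 3" by arith
  then show ?thesis
    unfolding sum dvd_eq_mod_eq_0 by cases (simp_all add: w power3_eq_cube)
qed

lemma power4_eq_1_complex:
  assumes "(z::complex) ^ 4 = 1"
  shows "\<exists>m<4. z = \<i> ^ m"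
proof -
  have "(z - 1) * (z + 1) * (z - \<i>) * (z + \<i>) = z ^ 4 - 1"
    by (simp add: algebra_simps eval_nat_numeral)
  then have "z = 1 \<or> z = -1 \<or> z = \<i> \<or> z = -\<i>"
    using assms by (auto simp: eq_neg_iff_add_eq_0)
  then show ?thesis
  proof (elim disjE)
    assume "z = 1"
    then show ?thesis by (intro exI[of _ 0]) simp
  next
    assume "z = -1"
    then show ?thesis by (intro exI[of _ 2]) simp
  next
    assume "z = \<i>"
    then show ?thesis by (intro exI[of _ 1]) simp
  next
    assume "z = -\<i>"
    then show ?thesis by (intro exI[of _ 3]) (simp add: power3_eq_cube)
  qed
qed

section \<open>Embeddings and trace of a pure quartic field\<close>

text \<open>The degree condition takes the place of irreducibility of
  \<open>x ^ 4 - a\<close>.\<close>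

locale pure_quartic =
  fixes a :: int and \<alpha> :: complex
  assumes root: "\<alpha> ^ 4 = of_int a"
    and degree_4: "field_degree (rat_adjoin \<alpha>) = 4"
begin

lemma degree_annihilator:
  assumes "f \<noteq> 0" "rp f \<alpha> = 0"
  shows "4 \<le> degree f"
  using field_degree_le[OF assms] degree_4 by simp

definition quartic :: "rat poly" where
  "quartic = monom 1 4 + [:- of_int a:]"

lemma degree_quartic: "degree quartic = 4" and quartic_nonzero: "quartic \<noteq> 0"
proof -
  show "degree quartic = 4"
    unfolding quartic_def by (subst degree_add_eq_left) (simp_all add: degree_monom_eq)
  then show "quartic \<noteq> 0" by auto
qed

lemma rp_quartic: "rp quartic z = z ^ 4 - of_int a"
  by (simp add: quartic_def of_rat_minus)

lemma rp_quartic_root: "rp quartic \<alpha> = 0"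
  by (simp add: rp_quartic root)

lemma alpha_nonzero: "\<alpha> \<noteq> 0"
  using degree_annihilator[of "[:0, 1:]"] by auto

lemma a_nonzero: "a \<noteq> 0"
  using root alpha_nonzero by auto

lemma field_eq: "rat_adjoin \<alpha> = range (\<lambda>f. rp f \<alpha>)"
  by (rule rat_adjoin_eq_range[OF quartic_nonzero rp_quartic_root])

lemma rp_mem: "rp f \<alpha> \<in> rat_adjoin \<alpha>"
  by (simp add: field_eq)

lemma field_elem:
  assumes "x \<in> rat_adjoin \<alpha>"
  obtains f where "degree f < 4" "x = rp f \<alpha>"
proof -
  obtain f where "x = rp f \<alpha>" using assms by (auto simp: field_eq)
  then show thesis
    using that[of "f mod quartic"] degree_mod_annihilator[OF quartic_nonzero rp_quartic_root]
    by (simp add: rp_mod[OF rp_quartic_root] degree_quartic)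
qed

text \<open>The remainder of \<open>f\<close> modulo \<open>quartic\<close> annihilates \<alpha> and
  has degree below 4, so it is zero. Thus \<open>quartic\<close> divides \<open>f\<close>, and all
  its roots are roots of \<open>f\<close>.\<close>

lemma rp_conjugate_0:
  assumes "rp f \<alpha> = 0" "z ^ 4 = of_int a"
  shows "rp f z = 0"
proof -
  have "degree (f mod quartic) < 4"
    using degree_mod_annihilator[OF quartic_nonzero rp_quartic_root] by (simp add: degree_quartic)
  moreover have "rp (f mod quartic) \<alpha> = 0"
    using assms(1) by (simp add: rp_mod[OF rp_quartic_root])
  ultimately have "f mod quartic = 0"
    using degree_annihilator[of "f mod quartic"] by linarith
  moreover have "rp (f mod quartic) z = rp f z"
    by (rule rp_mod) (simp add: rp_quartic assms)
  ultimately show ?thesis by simp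
qed

lemma rp_conjugate_eq:
  assumes "rp f \<alpha> = rp g \<alpha>" "z ^ 4 = of_int a"
  shows "rp f z = rp g z"
  using rp_conjugate_0[of "f - g" z] assms by simp

text \<open>Composed with \<open>f\<close>, a monic integer relation for
  \<open>rp f \<alpha>\<close> becomes a rational polynomial annihilating \<alpha>, hence also every
  conjugate \<open>z\<close>.\<close>

lemma algebraic_int_conjugate:
  assumes "algebraic_int (rp f \<alpha>)" "z ^ 4 = of_int a"
  shows "algebraic_int (rp f z)"
proof -
  obtain p where p: "poly (map_poly of_int p) (rp f \<alpha>) = 0" "lead_coeff p = 1"
    using assms(1) unfolding algebraic_int_altdef_ipoly by blast
  have "rp (pcompose (map_poly of_int p) f) \<alpha> = 0"
    by (simp add: rp_pcompose rp_of_int_poly p)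
  then have "rp (pcompose (map_poly of_int p) f) z = 0"
    by (rule rp_conjugate_0) fact
  then have "poly (map_poly of_int p) (rp f z) = 0"
    by (simp add: rp_pcompose rp_of_int_poly)
  then show ?thesis using p(2) unfolding algebraic_int_altdef_ipoly by blast
qed

lemma conjugate_root: "(\<i> ^ m * \<alpha>) ^ 4 = of_int a"
proof -
  have "(\<i> ^ m) ^ 4 = (\<i> ^ 4) ^ m" by (simp only: power_mult[symmetric] mult.commute)
  also have "\<i> ^ 4 = 1" by (simp add: eval_nat_numeral)
  finally show ?thesis by (simp add: power_mult_distrib root)
qed

text \<open>A discrete Fourier transform over the four conjugates isolates a single coefficient.\<close>

lemma algebraic_int_coeff:
  assumes deg: "degree f < 4" and int: "algebraic_int (rp f \<alpha>)" and k: "k < 4"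
  shows "algebraic_int (4 * of_rat (coeff f k) * \<alpha> ^ k)"
proof -
  \<comment> \<open>The exponent \<open>3 * k\<close> stands for \<open>- k\<close> modulo 4, which
    keeps it a natural number.\<close>
  have "(\<Sum>m<4. \<i> ^ (m * (3 * k)) * rp f (\<i> ^ m * \<alpha>))
      = (\<Sum>m<4. \<Sum>j<4. of_rat (coeff f j) * \<alpha> ^ j * \<i> ^ (m * (3 * k + j)))"
    by (simp add: rp_eq_sum[OF deg] sum_distrib_left power_mult_distrib power_add power_mult
        distrib_left mult_ac)
  also have "\<dots> = (\<Sum>j<4. of_rat (coeff f j) * \<alpha> ^ j * (\<Sum>m<4. \<i> ^ (m * (3 * k + j))))"
    by (subst sum.swap) (simp add: sum_distrib_left)
  also have "\<dots> = (\<Sum>j<4. if j = k then 4 * of_rat (coeff f k) * \<alpha> ^ k else 0)"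
  proof (rule sum.cong)
    fix j :: nat assume "j \<in> {..<4}"
    then have "4 dvd 3 * k + j \<longleftrightarrow> j = k" using k by simp presburger
    then show "of_rat (coeff f j) * \<alpha> ^ j * (\<Sum>m<4. \<i> ^ (m * (3 * k + j)))
        = (if j = k then 4 * of_rat (coeff f k) * \<alpha> ^ k else 0)"
      unfolding sum_powers_ii by simp
  qed simp
  also have "\<dots> = 4 * of_rat (coeff f k) * \<alpha> ^ k" using k by simp
  finally show ?thesis
    by (metis (no_types, lifting) algebraic_int_sum algebraic_int_add_mult(2) algebraic_int_power
        algebraic_int_ii algebraic_int_conjugate[OF int conjugate_root])
qed

text \<open>The choice of a representing polynomial does not affect the value, by
  \<open>rp_conjugate_eq\<close>. The restriction to the field gives the extensionality demanded by
  \<open>field_embeddings\<close>.\<close>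

definition embedding :: "nat \<Rightarrow> complex \<Rightarrow> complex" where
  "embedding m = (\<lambda>x\<in>rat_adjoin \<alpha>. rp (SOME f. rp f \<alpha> = x) (\<i> ^ m * \<alpha>))"

lemma embedding_rp: "embedding m (rp f \<alpha>) = rp f (\<i> ^ m * \<alpha>)"
proof -
  have "rp (SOME g. rp g \<alpha> = rp f \<alpha>) \<alpha> = rp f \<alpha>" by (rule someI) simp
  then have "rp (SOME g. rp g \<alpha> = rp f \<alpha>) (\<i> ^ m * \<alpha>) = rp f (\<i> ^ m * \<alpha>)"
    by (rule rp_conjugate_eq) (rule conjugate_root)
  then show ?thesis by (simp only: embedding_def restrict_apply' rp_mem)
qed

lemma embedding_mem: "embedding m \<in> field_embeddings (rat_adjoin \<alpha>)"
proof -
  have "embedding m (x + y) = embedding m x + embedding m y \<and>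
        embedding m (x * y) = embedding m x * embedding m y"
    if "x \<in> rat_adjoin \<alpha>" "y \<in> rat_adjoin \<alpha>" for x y
  proof -
    from that obtain f g where "x = rp f \<alpha>" "y = rp g \<alpha>" by (auto simp: field_eq)
    then show ?thesis
      using embedding_rp[of m "f + g"] embedding_rp[of m "f * g"] by (simp add: embedding_rp)
  qed
  moreover have "embedding m 1 = 1" using embedding_rp[of m 1] by simp
  moreover have "embedding m \<in> extensional (rat_adjoin \<alpha>)" by (simp add: embedding_def)
  ultimately show ?thesis by (simp add: field_embeddings_def)
qed

lemma field_subfield: "complex_subfield (rat_adjoin \<alpha>)"
  by (subst complex_subfield_def) (simp add: mem_rat_adjoin_iff complex_subfieldD)

text \<open>Additivity and multiplicativity with \<open>\<sigma> 1 = 1\<close> fix every rational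
  number, so an embedding is determined by the image of \<alpha>.\<close>

lemma hom_rp:
  assumes \<sigma>: "\<sigma> \<in> field_embeddings (rat_adjoin \<alpha>)"
  shows "\<sigma> (rp f \<alpha>) = rp f (\<sigma> \<alpha>)"
proof -
  let ?K = "rat_adjoin \<alpha>"
  note F = complex_subfieldD[OF field_subfield]
  have one: "\<sigma> 1 = 1"
    and add: "\<And>x y. x \<in> ?K \<Longrightarrow> y \<in> ?K \<Longrightarrow> \<sigma> (x + y) = \<sigma> x + \<sigma> y"
    and mult: "\<And>x y. x \<in> ?K \<Longrightarrow> y \<in> ?K \<Longrightarrow> \<sigma> (x * y) = \<sigma> x * \<sigma> y"
    using \<sigma> unfolding field_embeddings_def by blast+
  have zero: "\<sigma> 0 = 0" using add[of 0 0] F by simp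
  have neg: "\<sigma> (- x) = - \<sigma> x" if "x \<in> ?K" for x
    using add[of x "- x"] F that zero by (simp add: eq_neg_iff_add_eq_0 add.commute)
  have rat_mem: "of_rat q \<in> ?K" for q by (rule complex_subfield_of_rat[OF field_subfield])
  have int_mem: "of_int n \<in> ?K" for n using rat_mem[of "of_int n"] by simp
  have nat_mem: "of_nat n \<in> ?K" for n using int_mem[of "int n"] by simp
  have nat: "\<sigma> (of_nat n) = of_nat n" for n
    by (induction n) (simp_all add: zero one add F nat_mem)
  have int: "\<sigma> (of_int n) = of_int n" for n
    by (cases n rule: int_cases2) (simp_all add: nat neg nat_mem)
  have rat: "\<sigma> (of_rat q) = of_rat q" for q
  proof -
    obtain m n where mn: "quotient_of q = (m, n)" by (cases "quotient_of q")
    then have n: "n \<noteq> 0" using quotient_of_denom_pos[OF mn] by simp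
    \<comment> \<open>Clearing the denominator reduces the rational case to the integer case by
      multiplicativity alone.\<close>
    have q: "of_int n * of_rat q = (of_int m :: complex)"
      using n by (simp add: quotient_of_div[OF mn] of_rat_divide)
    then have "\<sigma> (of_int n * of_rat q) = of_int m" by (simp only: int)
    then have "of_int n * \<sigma> (of_rat q) = of_int m"
      by (simp only: mult[OF int_mem rat_mem] int)
    also note q[symmetric]
    finally show ?thesis using n by simp
  qed
  have "\<alpha> \<in> ?K" using rp_mem[of "[:0, 1:]"] by simp
  then show ?thesis
    by (induction f) (simp_all add: zero add mult rat rat_mem F rp_mem)
qed

text \<open>The image of \<alpha> is again a root of \<open>quartic\<close>, so it differs from
  \<alpha> by a fourth root of unity, that is, by a power of \<open>\<i>\<close>.\<close>

lemma field_embeddings_eq: "field_embeddings (rat_adjoin \<alpha>) = embedding ` {..<4}"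
proof (intro equalityI subsetI)
  fix \<sigma> assume \<sigma>: "\<sigma> \<in> field_embeddings (rat_adjoin \<alpha>)"
  have "rp quartic (\<sigma> \<alpha>) = \<sigma> 0"
    using hom_rp[OF \<sigma>, of quartic] by (simp add: rp_quartic_root)
  also have "\<sigma> 0 = 0" using hom_rp[OF \<sigma>, of 0] by simp
  finally have "(\<sigma> \<alpha> / \<alpha>) ^ 4 = 1"
    using a_nonzero by (simp add: rp_quartic power_divide root)
  from power4_eq_1_complex[OF this]
  obtain m where m: "m < 4" "\<sigma> \<alpha> / \<alpha> = \<i> ^ m" by blast
  from m(2) have m': "\<sigma> \<alpha> = \<i> ^ m * \<alpha>" using alpha_nonzero by (simp add: field_simps)
  have "\<sigma> = embedding m"
  proof (rule extensionalityI)
    fix x assume "x \<in> rat_adjoin \<alpha>"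
    then obtain f where "x = rp f \<alpha>" by (auto simp: field_eq)
    then show "\<sigma> x = embedding m x" by (simp add: hom_rp[OF \<sigma>] m' embedding_rp)
  next
    show "\<sigma> \<in> extensional (rat_adjoin \<alpha>)" using \<sigma> by (simp add: field_embeddings_def)
  qed (simp add: embedding_def)
  with m(1) show "\<sigma> \<in> embedding ` {..<4}" by blast
qed (auto intro: embedding_mem)

lemma inj_on_powers_ii: "inj_on (\<lambda>m. \<i> ^ m) {..<4::nat}"
proof -
  have "{..<4} = {0, 1, 2, 3::nat}" by auto
  then show ?thesis by (simp add: power3_eq_cube complex_eq_iff)
qed

text \<open>The four embeddings are distinct because they differ at \<alpha>; the sum over the set
  of embeddings is therefore a sum over \<open>m < 4\<close>.\<close>

lemma field_trace_rp: "field_trace (rat_adjoin \<alpha>) (rp f \<alpha>) = (\<Sum>m<4. rp f (\<i> ^ m * \<alpha>))"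
proof -
  have "inj_on embedding {..<4}"
  proof (rule inj_onI)
    fix m n :: nat assume mn: "m \<in> {..<4}" "n \<in> {..<4}" and eq: "embedding m = embedding n"
    have "embedding m (rp [:0, 1:] \<alpha>) = embedding n (rp [:0, 1:] \<alpha>)" by (simp only: eq)
    then have "\<i> ^ m = \<i> ^ n" unfolding embedding_rp using alpha_nonzero by simp
    with mn show "m = n" using inj_on_powers_ii by (simp add: inj_on_eq_iff)
  qed
  then show ?thesis
    unfolding field_trace_def field_embeddings_eq by (simp add: sum.reindex embedding_rp)
qed

end

section \<open>Integral bases\<close>

text \<open>A counterpart of \<open>integral_basis\<close> for arbitrary sets \<open>M\<close>, with
  coefficients as functions instead of lists, so that a basis can be extended by updating one
  index.\<close>

definition zbasis :: "complex set \<Rightarrow> nat \<Rightarrow> (nat \<Rightarrow> complex) \<Rightarrow> bool" where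
  "zbasis M n w \<longleftrightarrow>
     (\<forall>i<n. w i \<in> M) \<and>
     (\<forall>x\<in>M. \<exists>c. x = (\<Sum>i<n. of_int (c i) * w i)) \<and>
     (\<forall>c. (\<Sum>i<n. of_int (c i) * w i) = 0 \<longrightarrow> (\<forall>i<n. c i = 0))"

lemma zbasis_mem: "zbasis M n w \<Longrightarrow> i < n \<Longrightarrow> w i \<in> M"
  by (simp add: zbasis_def)

lemma zbasis_repr:
  assumes "zbasis M n w" "x \<in> M"
  obtains c where "x = (\<Sum>i<n. of_int (c i) * w i)"
  using assms(1)[unfolded zbasis_def, THEN conjunct2, THEN conjunct1, rule_format, OF assms(2)]
  by (rule exE)

lemma zbasis_indep:
  assumes "zbasis M n w" "(\<Sum>i<n. of_int (c i) * w i) = 0" "i < n"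
  shows "c i = 0"
  using assms(1)[unfolded zbasis_def, THEN conjunct2, THEN conjunct2, THEN spec[of _ c]] assms(2,3)
  by simp

lemma zbasis_unique:
  assumes "zbasis M n w" "(\<Sum>i<n. of_int (c i) * w i) = (\<Sum>i<n. of_int (d i) * w i)" "i < n"
  shows "c i = d i"
proof -
  have "(\<Sum>i<n. of_int (c i - d i) * w i) = 0"
    using assms(2) by (simp add: left_diff_distrib sum_subtractf)
  from zbasis_indep[OF assms(1) this assms(3)] show ?thesis by simp
qed

lemma sum_delta_of_int:
  fixes w :: "nat \<Rightarrow> complex"
  assumes "i < n"
  shows "(\<Sum>l<n. of_int (if l = i then N else 0) * w l) = of_int N * w i"
proof -
  have "(\<Sum>l<n. of_int (if l = i then N else 0) * w l) = (\<Sum>l<n. if l = i then of_int N * w l else 0)"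
    by (intro sum.cong) auto
  then show ?thesis using assms by simp
qed

lemma sum_matrix_product:
  fixes C :: "nat \<Rightarrow> int" and w v :: "nat \<Rightarrow> complex"
  assumes "\<And>j. j < m \<Longrightarrow> v j = (\<Sum>l<n. of_int (E j l) * w l)"
  shows "(\<Sum>j<m. of_int (C j) * v j) = (\<Sum>l<n. of_int (\<Sum>j<m. C j * E j l) * w l)"
proof -
  have "(\<Sum>j<m. of_int (C j) * v j) = (\<Sum>j<m. \<Sum>l<n. of_int (C j * E j l) * w l)"
  proof (rule sum.cong)
    fix j assume "j \<in> {..<m}"
    then show "of_int (C j) * v j = (\<Sum>l<n. of_int (C j * E j l) * w l)"
      by (simp only: lessThan_iff assms sum_distrib_left of_int_mult mult.assoc)
  qed simp
  also have "\<dots> = (\<Sum>l<n. \<Sum>j<m. of_int (C j * E j l) * w l)"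
    by (rule sum.swap)
  also have "\<dots> = (\<Sum>l<n. of_int (\<Sum>j<m. C j * E j l) * w l)"
    by (simp only: of_int_sum sum_distrib_right)
  finally show ?thesis .
qed

text \<open>The two transition matrices are mutually inverse, so both sizes equal the trace of their
  product.\<close>

lemma zbasis_size_unique:
  assumes w: "zbasis M n w" and v: "zbasis M m v"
  shows "n = m"
proof -
  have "\<forall>i\<in>{..<n}. \<exists>c. w i = (\<Sum>j<m. of_int (c j) * v j)"
  proof
    fix i assume "i \<in> {..<n}"
    then have "w i \<in> M" using zbasis_mem[OF w] by simp
    from zbasis_repr[OF v this] show "\<exists>c. w i = (\<Sum>j<m. of_int (c j) * v j)" by blast
  qed
  from bchoice[OF this] obtain C
    where "\<forall>i\<in>{..<n}. w i = (\<Sum>j<m. of_int (C i j) * v j)" by (rule exE)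
  then have C: "w i = (\<Sum>j<m. of_int (C i j) * v j)" if "i < n" for i
    by (rule bspec) (simp add: that)
  have "\<forall>j\<in>{..<m}. \<exists>c. v j = (\<Sum>i<n. of_int (c i) * w i)"
  proof
    fix j assume "j \<in> {..<m}"
    then have "v j \<in> M" using zbasis_mem[OF v] by simp
    from zbasis_repr[OF w this] show "\<exists>c. v j = (\<Sum>i<n. of_int (c i) * w i)" by blast
  qed
  from bchoice[OF this] obtain E
    where "\<forall>j\<in>{..<m}. v j = (\<Sum>i<n. of_int (E j i) * w i)" by (rule exE)
  then have E: "v j = (\<Sum>i<n. of_int (E j i) * w i)" if "j < m" for j
    by (rule bspec) (simp add: that)
  \<comment> \<open>A diagonal entry of the product of the transition matrices: expand
    \<open>w i\<close> in \<open>v\<close> and back in \<open>w\<close>, then compare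
    coordinates.\<close>
  have CE: "(\<Sum>j<m. C i j * E j i) = 1" if i: "i < n" for i
  proof -
    have "(\<Sum>l<n. of_int (if l = i then 1 else 0) * w l) = w i"
      using sum_delta_of_int[OF i, of 1 w] by simp
    also have "\<dots> = (\<Sum>j<m. of_int (C i j) * v j)" by (rule C[OF i])
    also have "\<dots> = (\<Sum>l<n. of_int (\<Sum>j<m. C i j * E j l) * w l)"
      by (rule sum_matrix_product[where C = "C i" and E = E and v = v]) (rule E)
    finally have "(\<Sum>l<n. of_int (if l = i then 1 else 0) * w l)
        = (\<Sum>l<n. of_int (\<Sum>j<m. C i j * E j l) * w l)" .
    from zbasis_unique[OF w this i] show ?thesis by simp
  qed
  have EC: "(\<Sum>i<n. E j i * C i j) = 1" if j: "j < m" for j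
  proof -
    have "(\<Sum>l<m. of_int (if l = j then 1 else 0) * v l) = v j"
      using sum_delta_of_int[OF j, of 1 v] by simp
    also have "\<dots> = (\<Sum>i<n. of_int (E j i) * w i)" by (rule E[OF j])
    also have "\<dots> = (\<Sum>l<m. of_int (\<Sum>i<n. E j i * C i l) * v l)"
      by (rule sum_matrix_product[where C = "E j" and E = C and v = w]) (rule C)
    finally have "(\<Sum>l<m. of_int (if l = j then 1 else 0) * v l)
        = (\<Sum>l<m. of_int (\<Sum>i<n. E j i * C i l) * v l)" .
    from zbasis_unique[OF v this j] show ?thesis by simp
  qed
  have "int n = (\<Sum>i<n. \<Sum>j<m. C i j * E j i)" by (simp add: CE)
  also have "\<dots> = (\<Sum>j<m. \<Sum>i<n. E j i * C i j)"
    by (subst sum.swap) (simp add: mult.commute)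
  also have "\<dots> = int m" by (simp add: EC)
  finally show ?thesis by simp
qed

text \<open>Triangular bases: among the elements of \<open>M\<close> supported on the first \<open>n + 1\<close> coordinates, one
  with least positive last coordinate completes a basis of those supported on the first \<open>n\<close>.\<close>

lemma zbasis_exists:
  assumes "zmod.subspace M"
    and "\<And>x. x \<in> M \<Longrightarrow> \<exists>m. x = (\<Sum>k<n. of_int (m k) * \<beta> k)"
    and "\<And>m. (\<Sum>k<n. of_int (m k) * \<beta> k) = 0 \<Longrightarrow> \<forall>k<n. m k = (0::int)"
    and "\<And>k. k < n \<Longrightarrow> \<exists>N. N \<noteq> 0 \<and> of_int N * \<beta> k \<in> M"
  shows "\<exists>w. zbasis M n w"
  using assms
proof (induction n arbitrary: M)
  case 0
  then show ?case by (simp add: zbasis_def)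
next
  case (Suc n)
  note sub = Suc.prems(1) and repr = Suc.prems(2) and indep = Suc.prems(3) and full = Suc.prems(4)
  have indep': "\<forall>k<n. m k = 0" "r = 0"
    if "(\<Sum>k<n. of_int (m k) * \<beta> k) + of_int r * \<beta> n = 0" for m :: "nat \<Rightarrow> int" and r
  proof -
    have "(\<Sum>k<Suc n. of_int ((m(n := r)) k) * \<beta> k) = 0"
      using that by simp
    from indep[OF this] have all: "(m(n := r)) k = 0" if "k < Suc n" for k using that by blast
    show "\<forall>k<n. m k = 0"
    proof (intro allI impI)
      fix k assume "k < n"
      then show "m k = 0" using all[of k] by simp
    qed
    show "r = 0" using all[of n] by simp
  qed
  \<comment> \<open>The lattice on the first \<open>n\<close> coordinates; the induction hypothesis
    is applied to \<open>M \<inter> P\<close>.\<close>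
  define P where "P = {x. \<exists>m :: nat \<Rightarrow> int. x = (\<Sum>k<n. of_int (m k) * \<beta> k)}"
  have P_I: "x \<in> P" if "x = (\<Sum>k<n. of_int (m k) * \<beta> k)" for x m
    unfolding P_def mem_Collect_eq by (rule exI[of _ m]) (rule that)
  have P_E: "\<exists>m. x = (\<Sum>k<n. of_int (m k) * \<beta> k)" if "x \<in> P" for x
    using that unfolding P_def mem_Collect_eq .
  have P: "zmod.subspace P"
  proof (rule zmod.subspaceI)
    show "0 \<in> P" by (rule P_I[of _ "\<lambda>_. 0"]) simp
  next
    fix x y assume xy: "x \<in> P" "y \<in> P"
    from P_E[OF xy(1)] obtain m where m: "x = (\<Sum>k<n. of_int (m k) * \<beta> k)" by (rule exE)
    from P_E[OF xy(2)] obtain m' where m': "y = (\<Sum>k<n. of_int (m' k) * \<beta> k)" by (rule exE)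
    show "x + y \<in> P"
      by (rule P_I[of _ "\<lambda>k. m k + m' k"]) (simp only: m m' of_int_add distrib_right sum.distrib)
  next
    fix c :: int and x assume "x \<in> P"
    from P_E[OF this] obtain m where m: "x = (\<Sum>k<n. of_int (m k) * \<beta> k)" by (rule exE)
    show "of_int c * x \<in> P"
      by (rule P_I[of _ "\<lambda>k. c * m k"]) (simp only: m of_int_mult sum_distrib_left mult.assoc)
  qed
  have "\<exists>w. zbasis (M \<inter> P) n w"
  proof (rule Suc.IH)
    show "zmod.subspace (M \<inter> P)" using sub P by (rule zmod.subspace_inter)
  next
    fix x assume "x \<in> M \<inter> P"
    then show "\<exists>m. x = (\<Sum>k<n. of_int (m k) * \<beta> k)" using P_E by simp
  next
    fix m :: "nat \<Rightarrow> int" assume "(\<Sum>k<n. of_int (m k) * \<beta> k) = 0"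
    then show "\<forall>k<n. m k = 0" using indep'(1)[of m 0] by simp
  next
    fix k assume k: "k < n"
    then obtain N where N: "N \<noteq> 0" "of_int N * \<beta> k \<in> M" using full[of k] by auto
    have "of_int N * \<beta> k = (\<Sum>l<n. of_int (if l = k then N else 0) * \<beta> l)"
      by (rule sum_delta_of_int[OF k, symmetric])
    then have "of_int N * \<beta> k \<in> P" by (rule P_I)
    with N show "\<exists>N. N \<noteq> 0 \<and> of_int N * \<beta> k \<in> M \<inter> P" by blast
  qed
  then obtain w where w: "zbasis (M \<inter> P) n w" by blast
  \<comment> \<open>The last coordinates that occur in \<open>M\<close>. They include a nonzero
    integer and are closed under negation, so a least positive one, \<open>d\<close>,
    exists.\<close>
  define L where "L = {r. \<exists>p\<in>P. p + of_int r * \<beta> n \<in> M}"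
  have L_I: "r \<in> L" if "p \<in> P" "p + of_int r * \<beta> n \<in> M" for p r
    unfolding L_def mem_Collect_eq by (rule bexI[of _ p]) (fact that)+
  have L_E: "\<exists>p\<in>P. p + of_int r * \<beta> n \<in> M" if "r \<in> L" for r
    using that by (simp add: L_def)
  obtain N where N: "N \<noteq> 0" "of_int N * \<beta> n \<in> M" using full[of n] by auto
  have L_N: "N \<in> L" using N zmod.subspace_0[OF P] by (intro L_I[of 0]) simp_all
  have L_minus: "- r \<in> L" if r: "r \<in> L" for r
  proof -
    from L_E[OF r] obtain p where p: "p \<in> P" "p + of_int r * \<beta> n \<in> M" by blast
    have "- p \<in> P" using p(1) by (rule zmod.subspace_neg[OF P])
    moreover have "- p + of_int (- r) * \<beta> n \<in> M"
      using zmod.subspace_neg[OF sub p(2)] by simp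
    ultimately show ?thesis by (rule L_I)
  qed
  have "\<bar>N\<bar> \<in> L" using L_N L_minus by (simp add: abs_if)
  then have "\<exists>d::nat. d > 0 \<and> int d \<in> L" using N by (intro exI[of _ "nat \<bar>N\<bar>"]) simp
  from LeastI_ex[OF this] not_less_Least[of _ "\<lambda>d. d > 0 \<and> int d \<in> L"]
  obtain d :: nat where d: "d > 0" "int d \<in> L" and min: "\<And>e. e < d \<Longrightarrow> \<not> (e > 0 \<and> int e \<in> L)"
    by blast
  from L_E[OF d(2)] obtain p where p: "p \<in> P" "p + of_int (int d) * \<beta> n \<in> M" by blast
  define v where "v = p + of_int (int d) * \<beta> n"
  have v: "v \<in> M" using p by (simp add: v_def)
  have "zbasis M (Suc n) (w(n := v))"
    unfolding zbasis_def
  proof (intro conjI allI impI ballI)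
    fix i assume "i < Suc n"
    then show "(w(n := v)) i \<in> M" using v zbasis_mem[OF w, of i] by auto
  next
    fix x assume x: "x \<in> M"
    from repr[OF this] obtain m where m: "x = (\<Sum>k<Suc n. of_int (m k) * \<beta> k)" by (rule exE)
    \<comment> \<open>Division with remainder by \<open>d\<close>: subtracting \<open>q\<close>
      copies of \<open>v\<close> leaves last coordinate \<open>r < d\<close>, which minimality
      forces to be 0.\<close>
    define q where "q = m n div int d"
    define r where "r = m n mod int d"
    define y where "y = x - of_int q * v"
    have y_M: "y \<in> M"
      unfolding y_def by (intro zmod.subspace_diff[OF sub] zmod.subspace_scale[OF sub] x v)
    define s where "s = (\<Sum>k<n. of_int (m k) * \<beta> k) - of_int q * p"
    have s: "s \<in> P" unfolding s_def
      by (intro zmod.subspace_diff[OF P] zmod.subspace_scale[OF P] p)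
        (rule P_I[OF refl])
    have "of_int (m n) = of_int q * of_int (int d) + (of_int r :: complex)"
      unfolding q_def r_def of_int_mult[symmetric] of_int_add[symmetric] by simp
    then have y: "y = s + of_int r * \<beta> n"
      unfolding y_def s_def v_def m by (simp add: algebra_simps)
    have "r \<in> L" using s y_M unfolding y by (rule L_I)
    moreover have "0 \<le> r" "r < int d" using d by (simp_all add: r_def)
    ultimately have "r = 0" using min[of "nat r"] by (cases "r = 0") (auto simp: nat_less_iff)
    with y y_M s have "y \<in> M \<inter> P" by simp
    then obtain c where c: "y = (\<Sum>i<n. of_int (c i) * w i)" by (rule zbasis_repr[OF w])
    have "x = y + of_int q * v" by (simp add: y_def)
    also have "\<dots> = (\<Sum>i<Suc n. of_int ((c(n := q)) i) * (w(n := v)) i)"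
      by (simp add: c)
    finally show "\<exists>c. x = (\<Sum>i<Suc n. of_int (c i) * (w(n := v)) i)"
      by (rule exI[of _ "c(n := q)"])
  next
    fix c :: "nat \<Rightarrow> int" and i
    assume eq: "(\<Sum>i<Suc n. of_int (c i) * (w(n := v)) i) = 0" and i: "i < Suc n"
    define t where "t = (\<Sum>i<n. of_int (c i) * w i)"
    from eq have eq': "t + of_int (c n) * v = 0" by (simp add: t_def)
    have "w i \<in> P" if "i < n" for i using zbasis_mem[OF w that] by simp
    then have "t + of_int (c n) * p \<in> P"
      unfolding t_def
      by (intro zmod.subspace_add[OF P] zmod.subspace_scale[OF P] zmod.subspace_sum[OF P] p) simp
    from P_E[OF this] obtain m where m: "t + of_int (c n) * p = (\<Sum>k<n. of_int (m k) * \<beta> k)"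
      by (rule exE)
    \<comment> \<open>Expanded in the \<beta>, the vanishing combination has last coordinate
      \<open>c n * d\<close>, so \<open>c n = 0\<close> and the relation drops to the first
      \<open>n\<close> vectors.\<close>
    have "(\<Sum>k<n. of_int (m k) * \<beta> k) + of_int (c n * int d) * \<beta> n = 0"
      unfolding m[symmetric] using eq' by (simp add: v_def algebra_simps)
    from indep'(2)[OF this] have cn: "c n = 0" using d by simp
    with eq' have "t = 0" by simp
    then have "c i = 0" if "i < n" using zbasis_indep[OF w _ that] by (simp add: t_def)
    with cn i show "c i = 0" by (auto simp: less_Suc_eq)
  qed
  then show ?case by blast
qed

lemma zbasis_imp_integral_basis:
  assumes w: "zbasis (ring_of_integers K) n w"
  shows "integral_basis K (map w [0..<n])"
proof -
  have sums: "(\<Sum>i<n. of_int (c ! i) * map w [0..<n] ! i) = (\<Sum>i<n. of_int (c ! i) * w i)"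
    for c :: "int list"
    by (rule sum.cong) simp_all
  have "\<exists>!c :: int list. length c = n \<and> x = (\<Sum>i<n. of_int (c ! i) * w i)"
    if "x \<in> ring_of_integers K" for x
  proof -
    from that obtain c where c: "x = (\<Sum>i<n. of_int (c i) * w i)" by (rule zbasis_repr[OF w])
    have map_c: "(\<Sum>i<n. of_int (map c [0..<n] ! i) * w i) = (\<Sum>i<n. of_int (c i) * w i)"
      by (rule sum.cong) simp_all
    show ?thesis
    proof (rule ex1I)
      show "length (map c [0..<n]) = n \<and> x = (\<Sum>i<n. of_int (map c [0..<n] ! i) * w i)"
        unfolding map_c using c by simp
    next
      fix e :: "int list"
      assume e: "length e = n \<and> x = (\<Sum>i<n. of_int (e ! i) * w i)"
      from e c have "(\<Sum>i<n. of_int (e ! i) * w i) = (\<Sum>i<n. of_int (c i) * w i)"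
        by metis
      from zbasis_unique[OF w this] e show "e = map c [0..<n]"
        by (intro nth_equalityI) simp_all
    qed
  qed
  moreover have "set (map w [0..<n]) \<subseteq> ring_of_integers K"
    using zbasis_mem[OF w] by auto
  ultimately show ?thesis
    by (simp add: integral_basis_def sums del: nth_map_upt)
qed

text \<open>Independence is the uniqueness of the coefficient list of 0, compared with the list of
  zeros. This makes the basis selected by \<open>SOME\<close> in the discriminant
  accessible.\<close>

lemma integral_basis_imp_zbasis:
  assumes \<omega>: "integral_basis K \<omega>" and zero: "0 \<in> K"
  shows "zbasis (ring_of_integers K) (length \<omega>) ((!) \<omega>)"
proof -
  let ?n = "length \<omega>"
  have unique: "\<exists>!c :: int list. length c = ?n \<and> x = (\<Sum>i<?n. of_int (c ! i) * \<omega> ! i)"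
    if "x \<in> ring_of_integers K" for x
    using \<omega>[unfolded integral_basis_def, THEN conjunct2] that by (rule bspec)
  have zero': "0 \<in> ring_of_integers K" using zero by (simp add: ring_of_integers_def)
  show ?thesis
    unfolding zbasis_def
  proof (intro conjI allI impI ballI)
    fix i assume "i < ?n"
    then show "\<omega> ! i \<in> ring_of_integers K"
      using \<omega>[unfolded integral_basis_def, THEN conjunct1] nth_mem by blast
  next
    fix x assume "x \<in> ring_of_integers K"
    from ex1_implies_ex[OF unique[OF this]]
    obtain c :: "int list" where "x = (\<Sum>i<?n. of_int (c ! i) * \<omega> ! i)" by blast
    then show "\<exists>c. x = (\<Sum>i<?n. of_int (c i) * \<omega> ! i)" by (rule exI[of _ "(!) c"])
  next
    fix c :: "nat \<Rightarrow> int" and i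
    assume "(\<Sum>i<?n. of_int (c i) * \<omega> ! i) = 0" and i: "i < ?n"
    then have "length (map c [0..<?n]) = ?n \<and> 0 = (\<Sum>i<?n. of_int (map c [0..<?n] ! i) * \<omega> ! i)"
      by simp
    moreover have "length (replicate ?n 0) = ?n \<and> 0 = (\<Sum>i<?n. of_int (replicate ?n 0 ! i) * \<omega> ! i)"
      by simp
    moreover from ex1E[OF unique[OF zero']] obtain u :: "int list" where
      "\<forall>y. length y = ?n \<and> 0 = (\<Sum>i<?n. of_int (y ! i) * \<omega> ! i) \<longrightarrow> y = u" by auto
    ultimately have "map c [0..<?n] = replicate ?n 0" by metis
    then have "map c [0..<?n] ! i = replicate ?n 0 ! i" by simp
    then show "c i = 0" using i by simp
  qed
qed

section \<open>The discriminant of a pure quartic field\<close>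

text \<open>A prime in the denominator of \<open>s\<close> would divide \<open>n ^ 3\<close> to the
  fourth power, whereas its exponent there is at most 3 for squarefree \<open>n\<close>.\<close>

lemma Ints_if_fourth_power:
  fixes s :: rat and n :: int
  assumes n: "squarefree n" and int: "s ^ 4 * of_int n ^ 3 \<in> \<int>"
  shows "s \<in> \<int>"
proof -
  obtain u v where uv: "quotient_of s = (u, v)" by (cases "quotient_of s")
  have v: "v > 0" by (rule quotient_of_denom_pos[OF uv])
  have cop: "coprime u v" by (rule quotient_of_coprime[OF uv])
  have s: "s = of_int u / of_int v" by (rule quotient_of_div[OF uv])
  from int obtain N where "s ^ 4 * of_int n ^ 3 = of_int N" by (rule Ints_cases)
  then have "of_int u ^ 4 * of_int n ^ 3 = (of_int N * of_int v ^ 4 :: rat)"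
    using v by (simp add: s power_divide field_simps)
  then have "of_int (u ^ 4 * n ^ 3) = (of_int (N * v ^ 4) :: rat)" by simp
  then have eq: "u ^ 4 * n ^ 3 = N * v ^ 4" by (simp only: of_int_eq_iff)
  have "v ^ 4 dvd u ^ 4 * n ^ 3" unfolding eq by simp
  moreover have "coprime (v ^ 4) (u ^ 4)" using cop by (simp add: coprime_commute)
  ultimately have dvd: "v ^ 4 dvd n ^ 3" by (simp add: coprime_dvd_mult_right_iff)
  have "is_unit v"
  proof (rule ccontr)
    assume "\<not> is_unit v"
    with v obtain p where p: "prime p" "p dvd v" using prime_divisor_exists[of v] by auto
    from n have n0: "n \<noteq> 0" by auto
    have "multiplicity p n \<le> 1"
      using n p n0 by (simp add: squarefree_factorial_semiring' prime_factors_multiplicity)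
        (metis le_eq_less_or_eq less_one not_le zero_less_iff_neq_zero)
    moreover have "p ^ 4 dvd n ^ 3" using p dvd by (meson dvd_power_same dvd_trans)
    then have "4 \<le> multiplicity p (n ^ 3)"
      using n0 p by (intro multiplicity_geI) auto
    moreover have "multiplicity p (n ^ 3) = 3 * multiplicity p n"
      using n0 p by (intro prime_elem_multiplicity_power_distrib) auto
    ultimately show False by simp
  qed
  with v have "v = 1" by simp
  then show ?thesis by (simp add: s)
qed

section \<open>The discrete Fourier matrix of order 4\<close>

definition fourier4 :: "complex mat" where
  "fourier4 = mat 4 4 (\<lambda>(k, m). \<i> ^ (m * k))"

text \<open>The square of the matrix is 4 times the permutation matrix \<open>P\<close> of negation
  modulo 4, and \<open>P * P\<close> is the identity. Hence the determinant has fourth power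
  \<open>4 ^ 8 = 16 ^ 4\<close>.\<close>

lemma norm_det_fourier4: "norm (det fourier4) = 16"
proof -
  define P :: "complex mat" where "P = mat 4 4 (\<lambda>(k, l). if k + l = 0 \<or> k + l = 4 then 1 else 0)"
  have carrier: "fourier4 \<in> carrier_mat 4 4" "P \<in> carrier_mat 4 4"
    by (simp_all add: fourier4_def P_def)
  have "fourier4 * fourier4 = 4 \<cdot>\<^sub>m P"
  proof (rule eq_matI)
    fix k l assume "k < dim_row (4 \<cdot>\<^sub>m P)" "l < dim_col (4 \<cdot>\<^sub>m P)"
    then have kl: "k < 4" "l < 4" by (simp_all add: P_def)
    have "(fourier4 * fourier4) $$ (k, l) = (\<Sum>m<4. \<i> ^ (m * k) * \<i> ^ (l * m))"
      using kl by (simp add: fourier4_def scalar_prod_def atLeast0LessThan)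
    also have "\<dots> = (\<Sum>m<4. \<i> ^ (m * (k + l)))"
      by (simp only: distrib_left power_add mult.commute[of l])
    moreover have "4 dvd k + l \<longleftrightarrow> k + l = 0 \<or> k + l = 4" using kl by presburger
    ultimately show "(fourier4 * fourier4) $$ (k, l) = (4 \<cdot>\<^sub>m P) $$ (k, l)"
      using kl by (simp add: sum_powers_ii P_def)
  qed (simp_all add: fourier4_def P_def)
  then have sq: "det fourier4 * det fourier4 = 4 ^ 4 * det P"
    using det_mult[OF carrier(1) carrier(1)] carrier by simp
  have "P * P = 1\<^sub>m 4"
  proof (rule eq_matI)
    fix k l assume "k < dim_row (1\<^sub>m 4 :: complex mat)" "l < dim_col (1\<^sub>m 4 :: complex mat)"
    then have kl: "k < 4" "l < 4" by simp_all
    have four: "{0..<4} = {0, 1, 2, 3::nat}" by auto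
    from kl have "k \<in> {0, 1, 2, 3}" "l \<in> {0, 1, 2, 3}" by auto
    then show "(P * P) $$ (k, l) = 1\<^sub>m 4 $$ (k, l)"
      by (auto simp: P_def scalar_prod_def four)
  qed (simp_all add: P_def)
  then have P: "det P * det P = 1"
    using det_mult[OF carrier(2) carrier(2)] by simp
  have "det fourier4 ^ 4 = (det fourier4 * det fourier4) * (det fourier4 * det fourier4)"
    by (simp add: eval_nat_numeral)
  also have "\<dots> = 4 ^ 4 * 4 ^ 4 * (det P * det P)" unfolding sq by (simp only: mult_ac)
  also have "\<dots> = 4 ^ 4 * 4 ^ 4" by (simp add: P)
  also have "(4 ^ 4 * 4 ^ 4 :: complex) = 16 ^ 4" by simp
  finally have "norm (det fourier4) ^ 4 = 16 ^ 4"
    by (metis norm_power norm_numeral)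
  then show ?thesis by (rule power_eq_imp_eq_base) simp_all
qed

section \<open>Integers and discriminant for a radicand free of fourth powers\<close>

locale reduced_pure_quartic = pure_quartic +
  fixes b c :: int
  assumes a_eq: "a = b * c ^ 3" and sqf: "squarefree (b * c)"
begin

lemma c_nonzero: "c \<noteq> 0" and b_nonzero: "b \<noteq> 0"
  using a_nonzero a_eq by auto

text \<open>The truncated exponents make the denominators \<open>4, 4, 4c, 4c\<^sup>2\<close>.\<close>

definition \<beta> :: "nat \<Rightarrow> complex" where
  "\<beta> k = \<alpha> ^ k / (4 * of_int c ^ (k - 1))"

text \<open>The fourth power of the integral number \<open>4 * coeff f k * \<alpha> ^ k\<close> is
  rational, hence an integer. After multiplication by a suitable integer it becomes a fourth power
  times \<open>(b * c) ^ 3\<close>, and \<open>b * c\<close> is squarefree.\<close>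

lemma coeff_denominator:
  assumes deg: "degree f < 4" and int: "algebraic_int (rp f \<alpha>)" and k: "k < 4"
  shows "4 * coeff f k * of_int c ^ (k - 1) \<in> \<int>"
proof (rule Ints_if_fourth_power[OF sqf])
  define t where "t = 4 * coeff f k"
  have "algebraic_int ((4 * of_rat (coeff f k) * \<alpha> ^ k) ^ 4)"
    by (intro algebraic_int_power algebraic_int_coeff deg int k)
  also have "(4 * of_rat (coeff f k) * \<alpha> ^ k) ^ 4 = of_rat t ^ 4 * (\<alpha> ^ 4) ^ k"
    by (simp add: t_def of_rat_mult power_mult_distrib power_mult[symmetric] mult.commute)
  also have "\<dots> = of_rat (t ^ 4 * of_int a ^ k)"
    by (simp add: root of_rat_mult of_rat_power)
  finally have "of_rat (t ^ 4 * of_int a ^ k) \<in> (\<int> :: complex set)"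
    by (rule rational_algebraic_int_is_int) simp
  then obtain N where "of_rat (t ^ 4 * of_int a ^ k) = (of_int N :: complex)" by (rule Ints_cases)
  also have "\<dots> = of_rat (of_int N)" by simp
  finally have N: "t ^ 4 * of_int a ^ k = of_int N" by (simp only: of_rat_eq_iff)
  \<comment> \<open>The quotient of \<open>(c ^ (k - 1)) ^ 4 * (b * c) ^ 3\<close> by
    \<open>a ^ k\<close>, an integer in each of the four cases; at \<open>k = 0\<close> the
    truncated exponent is 0.\<close>
  define M where "M = (if k = 0 then (b * c) ^ 3 else if k = 1 then b ^ 2 else if k = 2 then b * c else c ^ 2)"
  consider "k = 0" | "k = 1" | "k = 2" | "k = 3" using k by linarith
  then have "(c ^ (k - 1)) ^ 4 * (b * c) ^ 3 = a ^ k * M"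
    by cases (simp_all add: M_def a_eq algebra_simps eval_nat_numeral)
  then have "(of_int ((c ^ (k - 1)) ^ 4 * (b * c) ^ 3) :: rat) = of_int (a ^ k * M)" by simp
  then have "(of_int c ^ (k - 1)) ^ 4 * of_int (b * c) ^ 3 = (of_int a ^ k * of_int M :: rat)"
    by simp
  then have "(t * of_int c ^ (k - 1)) ^ 4 * of_int (b * c) ^ 3 = t ^ 4 * of_int a ^ k * of_int M"
    by (simp add: power_mult_distrib mult.assoc)
  also have "\<dots> = of_int (N * M)" by (simp add: N)
  finally show "(4 * coeff f k * of_int c ^ (k - 1)) ^ 4 * of_int (b * c) ^ 3 \<in> \<int>"
    unfolding t_def[symmetric] by simp
qed

lemma integer_repr:
  assumes "x \<in> ring_of_integers (rat_adjoin \<alpha>)"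
  shows "\<exists>m :: nat \<Rightarrow> int. x = (\<Sum>k<4. of_int (m k) * \<beta> k)"
proof -
  from assms have "x \<in> rat_adjoin \<alpha>" "algebraic_int x" by (simp_all add: ring_of_integers_def)
  then obtain f where f: "degree f < 4" "x = rp f \<alpha>" "algebraic_int (rp f \<alpha>)"
    using field_elem by metis
  have "\<forall>k\<in>{..<4}. \<exists>m. 4 * coeff f k * of_int c ^ (k - 1) = of_int m"
    using coeff_denominator[OF f(1) f(3)] by (auto elim: Ints_cases)
  from bchoice[OF this] obtain m
    where m: "\<forall>k\<in>{..<4}. 4 * coeff f k * of_int c ^ (k - 1) = of_int (m k)" by (rule exE)
  have "x = (\<Sum>k<4. of_rat (coeff f k) * \<alpha> ^ k)"
    unfolding f(2) by (rule rp_eq_sum[OF f(1)])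
  also have "\<dots> = (\<Sum>k<4. of_int (m k) * \<beta> k)"
  proof (rule sum.cong)
    fix k :: nat assume "k \<in> {..<4}"
    from bspec[OF m this] have "of_rat (4 * coeff f k * of_int c ^ (k - 1)) = (of_rat (of_int (m k)) :: complex)"
      by simp
    then have "4 * of_rat (coeff f k) * of_int c ^ (k - 1) = (of_int (m k) :: complex)"
      by (simp add: of_rat_mult of_rat_power)
    then show "of_rat (coeff f k) * \<alpha> ^ k = of_int (m k) * \<beta> k"
      using c_nonzero by (simp add: \<beta>_def field_simps)
  qed simp
  finally show ?thesis by (rule exI[of _ m])
qed

text \<open>Keeping a lattice point as a polynomial allows its evaluation at the conjugates as well
  as at \<alpha>.\<close>

definition coord_poly :: "(nat \<Rightarrow> int) \<Rightarrow> rat poly" where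
  "coord_poly m = (\<Sum>k<4. monom (of_int (m k) / (4 * of_int c ^ (k - 1))) k)"

lemma rp_coord_poly: "rp (coord_poly m) z = (\<Sum>k<4. of_int (m k) * (z ^ k / (4 * of_int c ^ (k - 1))))"
  unfolding coord_poly_def rp_sum by (simp add: of_rat_divide of_rat_mult of_rat_power)

lemma coeff_coord_poly: "coeff (coord_poly m) k = (if k < 4 then of_int (m k) / (4 * of_int c ^ (k - 1)) else 0)"
  by (simp add: coord_poly_def coeff_sum)

text \<open>A relation would give a polynomial of degree below 4 annihilating \<alpha>, which must
  be zero.\<close>

lemma \<beta>_indep:
  assumes "(\<Sum>k<4. of_int (m k) * \<beta> k) = 0"
  shows "\<forall>k<4. m k = 0"
proof -
  have "rp (coord_poly m) \<alpha> = 0" using assms by (simp add: rp_coord_poly \<beta>_def)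
  moreover have "degree (coord_poly m) < 4"
    by (rule le_less_trans[of _ 3]) (auto intro!: degree_le simp: coeff_coord_poly)
  ultimately have "coord_poly m = 0" using degree_annihilator[of "coord_poly m"] by linarith
  then have zero: "coeff (coord_poly m) k = 0" for k by simp
  show ?thesis
  proof (intro allI impI)
    fix k :: nat assume "k < 4"
    then show "m k = 0" using zero[of k] c_nonzero by (simp add: coeff_coord_poly)
  qed
qed

lemma alpha_integral: "algebraic_int \<alpha>"
proof (rule algebraic_int_root)
  show "poly (monom 1 4) \<alpha> = of_int a" by (simp add: poly_monom root)
qed (simp_all add: degree_monom_eq)

lemma ring_of_integers_subspace: "zmod.subspace (ring_of_integers (rat_adjoin \<alpha>))"
  using complex_subfieldD[OF field_subfield] complex_subfield_of_rat[OF field_subfield, of "of_int _"]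
  by (intro zmod.subspaceI) (auto simp: ring_of_integers_def intro: algebraic_int_add_mult)

text \<open>The integers form a subgroup of the lattice spanned by the \<beta>, of full rank because
  \<open>4 * c ^ (k - 1)\<close> times \<open>\<beta> k\<close> is the integer
  \<open>\<alpha> ^ k\<close>.\<close>

lemma zbasis_ring_of_integers: "\<exists>w. zbasis (ring_of_integers (rat_adjoin \<alpha>)) 4 w"
proof (rule zbasis_exists)
  show "zmod.subspace (ring_of_integers (rat_adjoin \<alpha>))" by (rule ring_of_integers_subspace)
next
  fix k :: nat assume "k < 4"
  have "of_int (4 * c ^ (k - 1)) * \<beta> k = \<alpha> ^ k" using c_nonzero by (simp add: \<beta>_def)
  also have "\<dots> \<in> ring_of_integers (rat_adjoin \<alpha>)"
    using rp_mem[of "monom 1 k"] by (simp add: ring_of_integers_def algebraic_int_power alpha_integral)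
  finally show "\<exists>N. N \<noteq> 0 \<and> of_int N * \<beta> k \<in> ring_of_integers (rat_adjoin \<alpha>)"
    using c_nonzero by (intro exI[of _ "4 * c ^ (k - 1)"]) simp
qed (fact integer_repr \<beta>_indep)+

text \<open>The exponents of \<alpha> add up to 6 and those of \<open>c\<close> to 3; twelve factors
  \<open>norm \<alpha>\<close> make \<open>\<bar>a\<bar> ^ 3\<close>, and dividing by
  \<open>\<bar>c\<bar> ^ 6\<close> leaves \<open>\<bar>b * c\<bar> ^ 3\<close>.\<close>

lemma norm_prod_\<beta>: "norm (\<Prod>k<4. \<beta> k) ^ 2 * 256 ^ 2 = \<bar>of_int (b * c)\<bar> ^ 3"
proof -
  have "(\<Prod>k<4. \<beta> k) = \<alpha> ^ 6 / (256 * of_int c ^ 3)"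
    by (simp add: \<beta>_def eval_nat_numeral)
  then have "norm (\<Prod>k<4. \<beta> k) ^ 2 * 256 ^ 2 = (norm \<alpha> ^ 6 / (256 * \<bar>of_int c\<bar> ^ 3)) ^ 2 * 256 ^ 2"
    by (simp add: norm_divide norm_mult norm_power)
  also have "\<dots> = (norm \<alpha> ^ 4) ^ 3 / \<bar>of_int c\<bar> ^ 6"
    by (simp add: power_divide power_mult_distrib power_mult[symmetric])
  also have "norm \<alpha> ^ 4 = \<bar>of_int a\<bar>"
    by (metis norm_of_int norm_power root)
  also have "\<bar>of_int a\<bar> ^ 3 / \<bar>of_int c\<bar> ^ 6 = (\<bar>of_int (b * c)\<bar> ^ 3 :: real)"
    using c_nonzero by (simp add: a_eq abs_mult power_abs field_simps eval_nat_numeral)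
  finally show ?thesis .
qed

text \<open>The discriminant is the square of the determinant of the matrix \<open>V\<close> of
  conjugates. \<open>V\<close> factors into an integer matrix \<open>M\<close>, a diagonal matrix
  \<open>B\<close> and \<open>fourier4\<close>; \<open>M\<close> is nonsingular, so its determinant
  has absolute value at least 1.\<close>

lemma discriminant_lower_bound:
  "\<bar>of_int (b * c)\<bar> ^ 3 \<le> 256 * norm (field_discriminant (rat_adjoin \<alpha>))"
proof -
  let ?K = "rat_adjoin \<alpha>"
  define \<omega> where "\<omega> = (SOME \<omega>. integral_basis ?K \<omega>)"
  obtain w0 where w0: "zbasis (ring_of_integers ?K) 4 w0" using zbasis_ring_of_integers by (rule exE)
  have basis: "integral_basis ?K \<omega>"
    unfolding \<omega>_def by (rule someI) (rule zbasis_imp_integral_basis[OF w0])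
  have w: "zbasis (ring_of_integers ?K) (length \<omega>) ((!) \<omega>)"
    by (rule integral_basis_imp_zbasis[OF basis]) (rule complex_subfieldD[OF field_subfield])
  have len: "length \<omega> = 4" by (rule zbasis_size_unique[OF w w0])
  have "\<forall>i\<in>{..<4}. \<exists>m. \<omega> ! i = (\<Sum>k<4. of_int (m k) * \<beta> k)"
  proof
    fix i :: nat assume "i \<in> {..<4}"
    then have "\<omega> ! i \<in> ring_of_integers ?K" using zbasis_mem[OF w] len by simp
    then show "\<exists>m. \<omega> ! i = (\<Sum>k<4. of_int (m k) * \<beta> k)" by (rule integer_repr)
  qed
  from bchoice[OF this] obtain C
    where "\<forall>i\<in>{..<4}. \<omega> ! i = (\<Sum>k<4. of_int (C i k) * \<beta> k)" by (rule exE)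
  then have C: "\<omega> ! i = (\<Sum>k<4. of_int (C i k) * \<beta> k)" if "i < 4" for i
    by (rule bspec) (simp add: that)
  have C': "\<omega> ! i = rp (coord_poly (C i)) \<alpha>" if "i < 4" for i
    unfolding rp_coord_poly C[OF that] \<beta>_def ..
  \<comment> \<open>Row \<open>i\<close> of \<open>M\<close> holds the \<beta>-coordinates of the
    basis element \<open>\<omega> ! i\<close>, and row \<open>i\<close> of \<open>V\<close> its four
    conjugates.\<close>
  define M where "M = mat 4 4 (\<lambda>(i, k). C i k)"
  define B where "B = mat 4 4 (\<lambda>(i, k). if i = k then \<beta> k else 0)"
  define V where "V = mat 4 4 (\<lambda>(i, m). rp (coord_poly (C i)) (\<i> ^ m * \<alpha>))"
  have carrier: "M \<in> carrier_mat 4 4" "B \<in> carrier_mat 4 4" "V \<in> carrier_mat 4 4"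
    "map_mat of_int M \<in> carrier_mat 4 4" "fourier4 \<in> carrier_mat 4 4"
    by (simp_all add: M_def B_def V_def fourier4_def)
  have "mat 4 4 (\<lambda>(i, j). field_trace ?K (\<omega> ! i * \<omega> ! j)) = V * transpose_mat V"
  proof (rule eq_matI)
    fix i j assume "i < dim_row (V * transpose_mat V)" "j < dim_col (V * transpose_mat V)"
    then have ij: "i < 4" "j < 4" by (simp_all add: V_def)
    have "field_trace ?K (\<omega> ! i * \<omega> ! j) = field_trace ?K (rp (coord_poly (C i) * coord_poly (C j)) \<alpha>)"
      by (simp only: C'[OF ij(1)] C'[OF ij(2)] rp_mult)
    also have "\<dots> = (\<Sum>m<4. rp (coord_poly (C i)) (\<i> ^ m * \<alpha>) * rp (coord_poly (C j)) (\<i> ^ m * \<alpha>))"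
      by (subst field_trace_rp) (simp only: rp_mult)
    finally show "mat 4 4 (\<lambda>(i, j). field_trace ?K (\<omega> ! i * \<omega> ! j)) $$ (i, j) = (V * transpose_mat V) $$ (i, j)"
      using ij by (simp add: V_def scalar_prod_def atLeast0LessThan)
  qed (simp_all add: V_def)
  then have disc: "field_discriminant ?K = det V * det V"
    using det_mult[OF carrier(3), of "transpose_mat V"] det_transpose[OF carrier(3)] carrier(3)
    by (simp add: field_discriminant_def \<omega>_def[symmetric] len)
  have "V = map_mat of_int M * (B * fourier4)"
  proof (rule eq_matI)
    fix i m assume "i < dim_row (map_mat of_int M * (B * fourier4))" "m < dim_col (map_mat of_int M * (B * fourier4))"
    then have im: "i < 4" "m < 4" by (simp_all add: M_def fourier4_def)
    have Bf: "(B * fourier4) $$ (k, m) = \<beta> k * \<i> ^ (m * k)" if "k < 4" for k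
    proof -
      have "(B * fourier4) $$ (k, m) = (\<Sum>l<4. (if k = l then \<beta> l else 0) * \<i> ^ (m * l))"
        using that im by (simp add: B_def fourier4_def scalar_prod_def atLeast0LessThan)
      also have "\<dots> = (\<Sum>l<4. if k = l then \<beta> l * \<i> ^ (m * l) else 0)"
        by (rule sum.cong) simp_all
      also have "\<dots> = \<beta> k * \<i> ^ (m * k)" using that by simp
      finally show ?thesis .
    qed
    have "V $$ (i, m) = (\<Sum>k<4. of_int (C i k) * (\<beta> k * \<i> ^ (m * k)))"
    proof -
      have "(\<i> ^ m * \<alpha>) ^ k = \<alpha> ^ k * \<i> ^ (m * k)" for k
        by (simp only: power_mult_distrib power_mult mult.commute[of _ "\<alpha> ^ k"])
      then show ?thesis using im by (simp add: V_def rp_coord_poly \<beta>_def)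
    qed
    also have "\<dots> = (\<Sum>k<4. of_int (C i k) * (B * fourier4) $$ (k, m))"
      using Bf by (intro sum.cong) auto
    also have "\<dots> = (map_mat of_int M * (B * fourier4)) $$ (i, m)"
      using im carrier by (simp add: M_def scalar_prod_def atLeast0LessThan)
    finally show "V $$ (i, m) = (map_mat of_int M * (B * fourier4)) $$ (i, m)" .
  qed (simp_all add: V_def M_def fourier4_def)
  then have "det V = det (map_mat of_int M) * (det B * det fourier4)"
    using det_mult[OF carrier(4), of "B * fourier4"] det_mult[OF carrier(2,5)] carrier by simp
  also have "det (map_mat of_int M) = (of_int (det M) :: complex)" by simp
  also have "det B = (\<Prod>k<4. \<beta> k)"
  proof -
    have "upper_triangular B" by (rule upper_triangularI) (simp add: B_def)
    then have "det B = prod_list (diag_mat B)" using carrier(2) by (rule det_upper_triangular)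
    also have "\<dots> = (\<Prod>k<4. \<beta> k)"
      using carrier(2) by (simp add: prod_list_diag_prod atLeast0LessThan B_def)
    finally show ?thesis .
  qed
  finally have norm_V: "norm (det V) = \<bar>of_int (det M)\<bar> * (norm (\<Prod>k<4. \<beta> k) * 16)"
    by (simp add: norm_mult norm_det_fourier4)
  \<comment> \<open>A singular \<open>M\<close> has a nonzero integer vector in its left kernel,
    which would be an integer relation between the basis elements.\<close>
  have "det M \<noteq> 0"
  proof
    assume "det M = 0"
    then have "det (transpose_mat M) = 0" using det_transpose[OF carrier(1)] by simp
    then obtain u where u: "u \<in> carrier_vec 4" "u \<noteq> 0\<^sub>v 4" "transpose_mat M *\<^sub>v u = 0\<^sub>v 4"
      using det_0_iff_vec_prod_zero[of "transpose_mat M" 4] carrier(1) by auto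
    have zero: "(\<Sum>i<4. u $ i * C i k) = 0" if "k < 4" for k
    proof -
      have "(transpose_mat M *\<^sub>v u) $ k = (\<Sum>i<4. u $ i * C i k)"
        using that u(1) by (simp add: M_def scalar_prod_def atLeast0LessThan mult.commute)
      then show ?thesis using u(3) that by simp
    qed
    have "(\<Sum>i<4. of_int (u $ i) * \<omega> ! i) = (\<Sum>k<4. of_int (\<Sum>i<4. u $ i * C i k) * \<beta> k)"
      by (rule sum_matrix_product) (rule C)
    also have "\<dots> = 0" using zero by simp
    finally have "(\<Sum>i<length \<omega>. of_int (u $ i) * \<omega> ! i) = 0" by (simp only: len)
    then have "u $ i = 0" if "i < 4" for i using zbasis_indep[OF w, of "($) u" i] that len by simp
    with u(1) have "u = 0\<^sub>v 4" by (intro eq_vecI) auto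
    with u(2) show False by simp
  qed
  then have "1 \<le> \<bar>of_int (det M) :: real\<bar>" by linarith
  then have "norm (\<Prod>k<4. \<beta> k) * 16 \<le> norm (det V)"
    unfolding norm_V by (simp add: mult_le_cancel_right1 mult_right_mono)
  then have "(norm (\<Prod>k<4. \<beta> k) * 16) ^ 2 \<le> norm (det V) ^ 2"
    by (rule power_mono) simp
  then have "256 * (norm (\<Prod>k<4. \<beta> k) ^ 2 * 256) \<le> 256 * norm (field_discriminant ?K)"
    by (simp add: disc norm_mult power2_eq_square)
  then show ?thesis using norm_prod_\<beta> by (simp add: power2_eq_square)
qed

end

section \<open>Counting\<close>

text \<open>Every subfield contains \<open>d\<close>, so \<alpha> and its quotient by
  \<open>d\<close> lie in the same subfields. This removes fourth powers from the radicand.\<close>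

lemma rat_adjoin_divide_of_int:
  assumes "d \<noteq> 0"
  shows "rat_adjoin (\<alpha> / of_int d) = rat_adjoin \<alpha>"
proof -
  have "\<alpha> / of_int d \<in> F \<longleftrightarrow> \<alpha> \<in> F" if F: "complex_subfield F" for F
  proof
    have d: "of_int d \<in> F" using complex_subfield_of_rat[OF F, of "of_int d"] by simp
    show "\<alpha> \<in> F" if "\<alpha> / of_int d \<in> F"
      using complex_subfieldD(4)[OF F that d] assms by simp
    show "\<alpha> / of_int d \<in> F" if "\<alpha> \<in> F"
      unfolding divide_inverse by (intro complex_subfieldD(4,6)[OF F] that d)
  qed
  then show ?thesis by (auto simp: set_eq_iff mem_rat_adjoin_iff)
qed

text \<open>Write \<open>a = s t\<^sup>2\<close> and \<open>t = s' t'\<^sup>2\<close> with \<open>s\<close>, \<open>s'\<close> squarefree; the exponents in \<open>a\<close> being odd, every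
  prime of \<open>a\<close>, hence every prime of \<open>s'\<close>, divides \<open>s\<close>.\<close>

lemma odd_exponents_decompose:
  fixes a :: int
  assumes a: "a \<noteq> 0" and odd: "\<And>p. p \<in> prime_factors a \<Longrightarrow> odd (multiplicity p a)"
  obtains b c d where "a = d ^ 4 * (b * c ^ 3)" "squarefree (b * c)" "d \<noteq> 0"
proof -
  define t where "t = square_part a"
  define s where "s = squarefree_part a"
  define c where "c = squarefree_part t"
  define d where "d = square_part t"
  have a_eq: "a = s * t ^ 2" unfolding s_def t_def by (rule squarefree_decompose)
  have t_eq: "t = c * d ^ 2" unfolding c_def d_def by (rule squarefree_decompose)
  from a a_eq have s0: "s \<noteq> 0" and t0: "t \<noteq> 0" by auto
  from t0 t_eq have c0: "c \<noteq> 0" and d0: "d \<noteq> 0" by auto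
  have sqf: "squarefree s" "squarefree c" by (simp_all add: s_def c_def)
  have "c dvd s"
  proof (rule multiplicity_le_imp_dvd)
    fix p :: int assume p: "prime p"
    show "multiplicity p c \<le> multiplicity p s"
    proof (cases "p dvd c")
      case False
      then show ?thesis by (simp add: not_dvd_imp_multiplicity_0)
    next
      case True
      then have "p dvd a" by (simp add: a_eq t_eq power2_eq_square)
      with a p have "odd (multiplicity p a)" by (intro odd) (simp add: in_prime_factors_iff)
      moreover have "multiplicity p a = multiplicity p s + 2 * multiplicity p t"
        unfolding a_eq using prime_imp_prime_elem[OF p] s0 t0
        by (simp add: prime_elem_multiplicity_mult_distrib prime_elem_multiplicity_power_distrib)
      \<comment> \<open>An odd number cannot be \<open>2 * multiplicity p t\<close> alone.\<close>
      ultimately have "1 \<le> multiplicity p s" by (cases "multiplicity p s") auto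
      moreover have "multiplicity p c \<le> 1"
      proof (rule ccontr)
        assume "\<not> multiplicity p c \<le> 1"
        then have "p ^ 2 dvd c" by (intro multiplicity_dvd') simp
        with sqf(2) have "is_unit p" by (rule squarefreeD)
        with p show False by auto
      qed
      ultimately show ?thesis by simp
    qed
  qed (use c0 s0 in auto)
  then obtain b where b: "s = c * b" by (rule dvdE)
  show thesis
  proof (rule that)
    show "a = d ^ 4 * (b * c ^ 3)"
      unfolding a_eq t_eq b by (simp add: eval_nat_numeral algebra_simps)
    show "squarefree (b * c)" using sqf(1) by (simp add: b mult.commute)
  qed (rule d0)
qed

section \<open>Bounding the number of fields by the number of pairs of radicand parts\<close>

definition fourth_root_fields :: "int \<Rightarrow> complex set set" where
  "fourth_root_fields a = rat_adjoin ` {z. z ^ 4 = of_int a}"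

lemma fourth_root_fields_finite_card:
  assumes "a \<noteq> 0"
  shows "finite (fourth_root_fields a)" "card (fourth_root_fields a) \<le> 4"
proof -
  have fin: "finite {z. z ^ 4 = (of_int a :: complex)}" by (rule finite_nth_roots) simp
  then show "finite (fourth_root_fields a)" by (simp add: fourth_root_fields_def)
  have "card (fourth_root_fields a) \<le> card {z. z ^ 4 = (of_int a :: complex)}"
    unfolding fourth_root_fields_def by (rule card_image_le[OF fin])
  also have "\<dots> = 4" by (rule card_nth_roots) (use assms in simp_all)
  finally show "card (fourth_root_fields a) \<le> 4" .
qed

text \<open>Exponents coprime to 4 are odd, so the radicand reduces to \<open>b * c ^ 3\<close>
  without changing the field. The discriminant bound then gives
  \<open>\<bar>b * c\<bar> \<le> Y\<close>, and each of the nonzero factors is at most the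
  product.\<close>

lemma pure_quartic_fields_subset:
  assumes Y: "256 * X \<le> real Y ^ 3"
  shows "pure_quartic_fields k1 k2 X
    \<subseteq> (\<Union>(b, c)\<in>({- int Y..int Y} - {0}) \<times> ({- int Y..int Y} - {0}). fourth_root_fields (b * c ^ 3))"
proof
  fix K assume "K \<in> pure_quartic_fields k1 k2 X"
  then obtain a \<alpha> where K: "field_degree K = 4" "norm (field_discriminant K) \<le> X"
    and \<alpha>: "\<alpha> ^ 4 = of_int a" "K = rat_adjoin \<alpha>" and a: "a \<noteq> 0"
    and gcd: "\<And>p. p \<in> prime_factors a \<Longrightarrow> gcd (multiplicity p a) 4 = 1"
    unfolding pure_quartic_fields_def by blast
  have "odd (multiplicity p a)" if "p \<in> prime_factors a" for p
  proof
    assume "even (multiplicity p a)"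
    then have "2 dvd gcd (multiplicity p a) 4" by simp
    with gcd[OF that] show False by simp
  qed
  from odd_exponents_decompose[OF a this]
  obtain b c d where dec: "a = d ^ 4 * (b * c ^ 3)" "squarefree (b * c)" "d \<noteq> 0" .
  define \<gamma> where "\<gamma> = \<alpha> / of_int d"
  have \<gamma>: "\<gamma> ^ 4 = of_int (b * c ^ 3)"
    using dec(3) by (simp add: \<gamma>_def power_divide \<alpha>(1) dec(1))
  have K_eq: "K = rat_adjoin \<gamma>"
    unfolding \<alpha>(2) \<gamma>_def by (rule rat_adjoin_divide_of_int[OF dec(3), symmetric])
  interpret reduced_pure_quartic "b * c ^ 3" \<gamma> b c
    by unfold_locales (use \<gamma> K K_eq dec in simp_all)
  have "\<bar>of_int (b * c)\<bar> ^ 3 \<le> 256 * norm (field_discriminant K)"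
    unfolding K_eq by (rule discriminant_lower_bound)
  also have "\<dots> \<le> real Y ^ 3" using K(2) Y by linarith
  finally have "\<bar>of_int (b * c)\<bar> \<le> real Y"
    by (subst (asm) power_mono_iff) simp_all
  then have "of_int \<bar>b * c\<bar> \<le> (of_int (int Y) :: real)"
    by (simp only: of_int_abs of_int_of_nat_eq)
  then have bc: "\<bar>b\<bar> * \<bar>c\<bar> \<le> int Y" by (simp only: of_int_le_iff abs_mult)
  have "\<bar>b\<bar> * 1 \<le> \<bar>b\<bar> * \<bar>c\<bar>" "1 * \<bar>c\<bar> \<le> \<bar>b\<bar> * \<bar>c\<bar>"
    using b_nonzero c_nonzero by (intro mult_mono; simp)+
  with bc have "\<bar>b\<bar> \<le> int Y" "\<bar>c\<bar> \<le> int Y" by linarith+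
  then have "b \<in> {- int Y..int Y} - {0}" "c \<in> {- int Y..int Y} - {0}"
    using b_nonzero c_nonzero by auto
  moreover have "K \<in> fourth_root_fields (b * c ^ 3)"
    unfolding fourth_root_fields_def K_eq using \<gamma> by blast
  ultimately show "K \<in> (\<Union>(b, c)\<in>({- int Y..int Y} - {0}) \<times> ({- int Y..int Y} - {0}).
      fourth_root_fields (b * c ^ 3))"
    by blast
qed

text \<open>Isomorphism classes are at most as many as the fields themselves, and these come from
  \<open>4 * Y ^ 2\<close> pairs with at most four fields each.\<close>

lemma count_pure_quartic_le:
  assumes Y: "256 * X \<le> real Y ^ 3"
  shows "count_pure_quartic k1 k2 X \<le> 16 * Y ^ 2"
proof -
  define I where "I = ({- int Y..int Y} - {0}) \<times> ({- int Y..int Y} - {0})"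
  define U where "U = (\<Union>(b, c)\<in>I. fourth_root_fields (b * c ^ 3))"
  have fin_I: "finite I" by (simp add: I_def)
  have "card ({- int Y..int Y} - {0}) = 2 * Y"
    by (simp add: card_Diff_singleton)
  then have card_I: "card I = 4 * Y ^ 2"
    by (simp add: I_def card_cartesian_product power2_eq_square)
  have fin_U: "finite U"
    unfolding U_def using fin_I by (rule finite_UN_I) (auto simp: I_def intro: fourth_root_fields_finite_card)
  have sub: "pure_quartic_fields k1 k2 X \<subseteq> U"
    unfolding U_def I_def by (rule pure_quartic_fields_subset[OF Y])
  have "count_pure_quartic k1 k2 X \<le> card (pure_quartic_fields k1 k2 X)"
    unfolding count_pure_quartic_def quotient_def UNION_singleton_eq_range
    by (rule card_image_le[OF finite_subset[OF sub fin_U]])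
  also have "\<dots> \<le> card U" by (rule card_mono[OF fin_U sub])
  also have "\<dots> \<le> (\<Sum>(b, c)\<in>I. card (fourth_root_fields (b * c ^ 3)))"
    unfolding U_def using card_UN_le[OF fin_I, of "\<lambda>(b, c). fourth_root_fields (b * c ^ 3)"]
    by (simp add: case_prod_unfold)
  also have "\<dots> \<le> (\<Sum>_\<in>I. 4)"
    by (rule sum_mono) (auto simp: I_def intro: fourth_root_fields_finite_card)
  also have "\<dots> = 16 * Y ^ 2" by (simp add: card_I)
  finally show ?thesis .
qed

theorem theorem6p2:
  fixes k1 k2 k :: nat
  assumes "k = k1 + k2" and "k \<ge> 1"
  shows "(\<lambda>X::real. real (count_pure_quartic k1 k2 X))
           \<in> O[at_top](\<lambda>X. X / (fact (k - 1) * ln X) * ln (ln X) ^ (k - 1))"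
proof -
  have count: "real (count_pure_quartic k1 k2 X) \<le> 16 * (7 * X powr (1 / 3) + 1) ^ 2" if "X \<ge> 0" for X
  proof -
    \<comment> \<open>The factor 7 works because \<open>7 ^ 3 = 343\<close> exceeds 256; rounding up
      costs at most 1.\<close>
    define Y where "Y = nat \<lceil>7 * X powr (1 / 3)\<rceil>"
    have Y: "7 * X powr (1 / 3) \<le> real Y" "real Y \<le> 7 * X powr (1 / 3) + 1"
      unfolding Y_def using powr_ge_zero[of X "1 / 3"] by linarith+
    have "256 * X \<le> (7 * X powr (1 / 3)) ^ 3"
      using that by (cases "X = 0") (simp_all add: power_mult_distrib powr_power)
    also have "\<dots> \<le> real Y ^ 3" by (rule power_mono[OF Y(1)]) simp
    finally have "count_pure_quartic k1 k2 X \<le> 16 * Y ^ 2" by (rule count_pure_quartic_le)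
    then have "real (count_pure_quartic k1 k2 X) \<le> real (16 * Y ^ 2)" by (simp only: of_nat_le_iff)
    also have "\<dots> = 16 * real Y ^ 2" by simp
    also have "\<dots> \<le> 16 * (7 * X powr (1 / 3) + 1) ^ 2"
      by (intro mult_left_mono power_mono Y) simp_all
    finally show ?thesis .
  qed
  have "(\<lambda>X. real (count_pure_quartic k1 k2 X)) \<in> O[at_top](\<lambda>X. 16 * (7 * X powr (1 / 3) + 1) ^ 2)"
    by (rule landau_o.big_mono, rule eventually_mono[OF eventually_ge_at_top[of 0]])
      (simp add: count)
  \<comment> \<open>The left side has order \<open>X powr (2 / 3)\<close>, a power saving that
    absorbs the logarithm.\<close>
  also have "(\<lambda>X::real. 16 * (7 * X powr (1 / 3) + 1) ^ 2) \<in> O[at_top](\<lambda>X. X / ln X)"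
    by real_asymp
  also have "(\<lambda>X::real. X / ln X) \<in> O[at_top](\<lambda>X. X / (fact (k - 1) * ln X) * ln (ln X) ^ (k - 1))"
  proof (rule bigoI)
    \<comment> \<open>Once \<open>ln (ln X) \<ge> 1\<close>, its power is at least 1 and can be
      inserted; the constant \<open>fact (k - 1)\<close> cancels the factorial in the
      denominator.\<close>
    have "eventually (\<lambda>X::real. X \<ge> 0 \<and> ln X > 0 \<and> ln (ln X) \<ge> 1) at_top"
      by (intro eventually_conj) real_asymp+
    then show "eventually (\<lambda>X::real. norm (X / ln X)
        \<le> fact (k - 1) * norm (X / (fact (k - 1) * ln X) * ln (ln X) ^ (k - 1))) at_top"
    proof eventually_elim
      case (elim X)
      then have "X / ln X * 1 \<le> X / ln X * ln (ln X) ^ (k - 1)"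
        by (intro mult_left_mono one_le_power) auto
      moreover have "\<bar>ln (ln X)\<bar> = ln (ln X)" using elim by (intro abs_of_nonneg) linarith
      ultimately show ?case using elim by (simp add: abs_mult power_abs)
    qed
  qed
  finally show ?thesis .
qed

end
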